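(* Let $t$ be an arbitrary monotone, strict aggregation function with $m$ arguments. Let $\mathbf{D}$ be the class of all databases (with $m$ sorted lists). Let $\mathbf{A}$ be the class of all algorithms that correctly find the top $k$ answers for $t$ for every database and that do not make wild guesses. Then the threshold algorithm TA is instance optimal over $\mathbf{A}$ and $\mathbf{D}$, with optimality ratio $m+m(m-1)c_R/c_S$. No deterministic algorithm has a lower optimality ratio (that is, no deterministic algorithm is instance optimal over $\mathbf A$ and $\mathbf D$ with optimality ratio less than $m+m(m-1)c_R/c_S$).
   Context: Setting: fix positive integers $m$ and $k$ (treated as constants). A database consists of a finite set of $N\ge k$ objects; each object $R$ has $m$ grades (fields) $x_1,\dots,x_m\in[0,1]$. It is presented as $m$ sorted lists $L_1,\dots,L_m$ of length $N$; list $L_i$ contains one entry $(R,x_i)$ for each object $R$, where $x_i$ is the $i$th grade of $R$, in descending order of $x_i$ (the order among ties is part of the database). An aggregation function is a fixed function $t:[0,1]^m\to[0,\infty)$; the overall grade of $R$ is $t(R)=t(x_1,\dots,x_m)$. $t$ is monotone if $t(x_1,\dots,x_m)\le t(x_1',\dots,x_m')$ whenever $x_i\le x_i'$ for every $i$. $t$ is strict if $t(x_1,\dots,x_m)=1$ holds precisely when $x_i=1$ for every $i$. The top $k$ answers are $k$ objects with the highest overall grades (ties broken arbitrarily), each along with its overall grade. Access and cost: an algorithm obtains information about the database only by sorted access (reading the next entry of some list, proceeding sequentially from the top) and random access (requesting the grade of a given object in a given list, obtained in one step; the object may be one not previously seen). Internal computation is free. With $s$ sorted and $r$ random accesses the middleware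 cost is $s c_S+r c_R$, where $c_S,c_R>0$ are fixed constants; $cost(\mathcal A,\mathcal D)$ is the middleware cost of algorithm $\mathcal A$ on database $\mathcal D$. An algorithm makes wild guesses if it does random access to find the grade of some object in some list before having seen that object under sorted access. Instance optimality: algorithm $\mathcal B$ is instance optimal over $\mathbf A$ and $\mathbf D$ with optimality ratio $c$ if $\mathcal B\in\mathbf A$ and there is a constant $c'$ such that $cost(\mathcal B,\mathcal D)\le c\cdot cost(\mathcal A,\mathcal D)+c'$ for every $\mathcal A\in\mathbf A$ and $\mathcal D\in\mathbf D$. Algorithm TA: (1) Do sorted access in parallel to each of the $m$ lists (top entry of each list, then second entry of each list, and so on). As an object $R$ is seen under sorted access in some list, do random access to the other lists to find all its grades, and compute $t(R)$. If this grade is one of the $k$ highest seen, remember $R$ and $t(R)$ (ties broken arbitrarily, only $k$ objects remembered). (2) For each $i$ let $\underline{x}_i$ be the grade of the last object seen under sorted access in $L_i$, and let the threshold value be $\tau=t(\underline{x}_1,\dots,\underline{x}_m)$. As soon as at least $k$ objects have been seen whose grade is at least $\tau$, halt. (3) Output the $k$ seen objects with highest grades, with their grades.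
   Formalization: The claim that no deterministic algorithm has a lower optimality ratio is stated only for m at least 2; for m = 1 it is false, since TA then halts after at most k sorted accesses and so has optimality ratio 0 with constant c' = k c_S. *)

theory Defs
  imports Complex_Main "HOL-Library.Infinite_Typeclass"
begin

section \<open>Aggregation functions\<close>

text \<open>A point of $[0,1]^m$ is a list of length \<open>m\<close>; the values of an aggregation function
  outside \<open>unit_cube m\<close> play no role.\<close>

definition unit_cube :: "nat \<Rightarrow> real list set" where
  "unit_cube m = {xs. length xs = m \<and> set xs \<subseteq> {0..1}}"

definition aggregation :: "nat \<Rightarrow> (real list \<Rightarrow> real) \<Rightarrow> bool" where
  "aggregation m t \<longleftrightarrow> (\<forall>xs\<in>unit_cube m. 0 \<le> t xs)"

definition monotone_aggregation :: "nat \<Rightarrow> (real list \<Rightarrow> real) \<Rightarrow> bool" where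
  "monotone_aggregation m t \<longleftrightarrow>
     (\<forall>xs\<in>unit_cube m. \<forall>ys\<in>unit_cube m. (\<forall>i<m. xs ! i \<le> ys ! i) \<longrightarrow> t xs \<le> t ys)"

definition strict_aggregation :: "nat \<Rightarrow> (real list \<Rightarrow> real) \<Rightarrow> bool" where
  "strict_aggregation m t \<longleftrightarrow> (\<forall>xs\<in>unit_cube m. t xs = 1 \<longleftrightarrow> (\<forall>i<m. xs ! i = 1))"

section \<open>Databases\<close>

text \<open>Element \<open>i\<close> of the list is the sorted list $L_{i+1}$; ties are ordered by the list itself.
  Object names come from a type \<open>'a\<close> that will be infinite.\<close>

type_synonym 'a database = "('a \<times> real) list list"

definition objects :: "'a database \<Rightarrow> 'a set" where
  "objects D = (\<Union>L\<in>set D. fst ` set L)"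

definition databases :: "nat \<Rightarrow> nat \<Rightarrow> 'a database set" where
  "databases k m = {D. length D = m \<and> k \<le> card (objects D) \<and>
     (\<forall>L\<in>set D. distinct (map fst L) \<and> fst ` set L = objects D \<and>
        snd ` set L \<subseteq> {0..1} \<and> sorted_wrt (\<ge>) (map snd L))}"

definition overall_grade :: "(real list \<Rightarrow> real) \<Rightarrow> 'a database \<Rightarrow> 'a \<Rightarrow> real" where
  "overall_grade t D R = t (map (\<lambda>L. the (map_of L R)) D)"

definition is_top :: "nat \<Rightarrow> ('a \<Rightarrow> real) \<Rightarrow> 'a set \<Rightarrow> 'a set \<Rightarrow> bool" where
  "is_top k g X S \<longleftrightarrow> S \<subseteq> X \<and> card S = k \<and> (\<forall>R\<in>S. \<forall>R'\<in>X - S. g R' \<le> g R)"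

definition top_answers :: "nat \<Rightarrow> (real list \<Rightarrow> real) \<Rightarrow> 'a database \<Rightarrow> ('a \<times> real) set \<Rightarrow> bool" where
  "top_answers k t D Y \<longleftrightarrow>
     (\<exists>S. is_top k (overall_grade t D) (objects D) S \<and> Y = (\<lambda>R. (R, overall_grade t D R)) ` S)"

section \<open>Algorithms\<close>

text \<open>An algorithm knows nothing about the database (not even its size) except the chronological
  history of its own accesses and their results. As internal computation is free, it is a map from
  histories to possible next actions. Several possible actions mean a nondeterministic (for
  example, randomized) choice.\<close>

datatype 'a event =
  Sorted_Event nat "('a \<times> real) option"
| Random_Event 'a nat "real option"

datatype 'a action =
  Do_Sorted nat
| Do_Random 'a nat
| Halt "('a \<times> real) set"

type_synonym 'a algorithm = "'a event list \<Rightarrow> 'a action set"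

definition deterministic :: "'a algorithm \<Rightarrow> bool" where
  "deterministic A \<longleftrightarrow> (\<forall>h. is_singleton (A h))"

fun entries_seen :: "nat \<Rightarrow> 'a event list \<Rightarrow> ('a \<times> real) list" where
  "entries_seen i [] = []"
| "entries_seen i (Sorted_Event j (Some e) # h) =
     (if j = i then e # entries_seen i h else entries_seen i h)"
| "entries_seen i (_ # h) = entries_seen i h"

definition seen :: "'a event list \<Rightarrow> 'a set" where
  "seen h = {R. \<exists>i. R \<in> fst ` set (entries_seen i h)}"

text \<open>Accesses to a nonexistent list, past the end of a list, or to a nonexistent object return
  \<open>None\<close>; they are charged like any other access.\<close>

definition sorted_result :: "'a database \<Rightarrow> 'a event list \<Rightarrow> nat \<Rightarrow> ('a \<times> real) option" where
  "sorted_result D h i = (let n = length (entries_seen i h) in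
     if i < length D \<and> n < length (D ! i) then Some (D ! i ! n) else None)"

definition random_result :: "'a database \<Rightarrow> 'a \<Rightarrow> nat \<Rightarrow> real option" where
  "random_result D R i = (if i < length D then map_of (D ! i) R else None)"

inductive reachable :: "'a algorithm \<Rightarrow> 'a database \<Rightarrow> 'a event list \<Rightarrow> bool" for A D where
  start: "reachable A D []"
| sorted_step: "reachable A D h \<Longrightarrow> Do_Sorted i \<in> A h \<Longrightarrow>
     reachable A D (h @ [Sorted_Event i (sorted_result D h i)])"
| random_step: "reachable A D h \<Longrightarrow> Do_Random R i \<in> A h \<Longrightarrow>
     reachable A D (h @ [Random_Event R i (random_result D R i)])"

definition halts_with :: "'a algorithm \<Rightarrow> 'a database \<Rightarrow> 'a event list \<Rightarrow> ('a \<times> real) set \<Rightarrow> bool" where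
  "halts_with A D h Y \<longleftrightarrow> reachable A D h \<and> Halt Y \<in> A h"

text \<open>A deterministic algorithm has exactly one branch, so correctness says that it halts with the
  top \<open>k\<close> answers. A nondeterministic one must halt on some branch and never answer wrongly.\<close>

definition correct :: "nat \<Rightarrow> nat \<Rightarrow> (real list \<Rightarrow> real) \<Rightarrow> 'a algorithm \<Rightarrow> bool" where
  "correct k m t A \<longleftrightarrow> (\<forall>D\<in>databases k m.
     (\<exists>h Y. halts_with A D h Y) \<and> (\<forall>h Y. halts_with A D h Y \<longrightarrow> top_answers k t D Y))"

definition no_wild_guesses :: "nat \<Rightarrow> nat \<Rightarrow> 'a algorithm \<Rightarrow> bool" where
  "no_wild_guesses k m A \<longleftrightarrow> (\<forall>D\<in>databases k m. \<forall>h R i.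
     reachable A D h \<and> Do_Random R i \<in> A h \<longrightarrow> R \<in> seen h)"

definition algorithms :: "nat \<Rightarrow> nat \<Rightarrow> (real list \<Rightarrow> real) \<Rightarrow> 'a algorithm set" where
  "algorithms k m t = {A. correct k m t A \<and> no_wild_guesses k m A}"

section \<open>Cost and instance optimality\<close>

fun event_cost :: "real \<Rightarrow> real \<Rightarrow> 'a event \<Rightarrow> real" where
  "event_cost cS cR (Sorted_Event _ _) = cS"
| "event_cost cS cR (Random_Event _ _ _) = cR"

text \<open>For a deterministic algorithm the infimum is over the single halting history; for a
  nondeterministic one it is the cost of a cheapest halting branch.\<close>

definition middleware_cost :: "real \<Rightarrow> real \<Rightarrow> 'a algorithm \<Rightarrow> 'a database \<Rightarrow> real" where
  "middleware_cost cS cR A D =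
     Inf {sum_list (map (event_cost cS cR) h) | h. \<exists>Y. halts_with A D h Y}"

definition instance_optimal ::
  "('b \<Rightarrow> 'd \<Rightarrow> real) \<Rightarrow> 'b set \<Rightarrow> 'd set \<Rightarrow> 'b \<Rightarrow> real \<Rightarrow> bool" where
  "instance_optimal cost As Ds B c \<longleftrightarrow>
     B \<in> As \<and> (\<exists>c'. \<forall>A\<in>As. \<forall>D\<in>Ds. cost B D \<le> c * cost A D + c')"

section \<open>The threshold algorithm\<close>

text \<open>\<open>seen_grade\<close> and \<open>threshold\<close> are computed from the history alone; they are used only when all
  grades of \<open>R\<close> have been retrieved, respectively when every list has been accessed.\<close>

definition retrieved_grade :: "'a event list \<Rightarrow> 'a \<Rightarrow> nat \<Rightarrow> real" where
  "retrieved_grade h R i =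
     (THE x. Sorted_Event i (Some (R, x)) \<in> set h \<or> Random_Event R i (Some x) \<in> set h)"

definition seen_grade :: "nat \<Rightarrow> (real list \<Rightarrow> real) \<Rightarrow> 'a event list \<Rightarrow> 'a \<Rightarrow> real" where
  "seen_grade m t h R = t (map (retrieved_grade h R) [0..<m])"

definition threshold :: "nat \<Rightarrow> (real list \<Rightarrow> real) \<Rightarrow> 'a event list \<Rightarrow> real" where
  "threshold m t h = t (map (\<lambda>i. snd (last (entries_seen i h))) [0..<m])"

definition ta_stops :: "nat \<Rightarrow> nat \<Rightarrow> (real list \<Rightarrow> real) \<Rightarrow> 'a event list \<Rightarrow> bool" where
  "ta_stops k m t h \<longleftrightarrow> k \<le> card {R \<in> seen h. threshold m t h \<le> seen_grade m t h R}"

text \<open>How TA breaks ties when it keeps \<open>k\<close> best seen objects: \<open>tie h\<close> is the set it keeps.\<close>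

definition tie_breaking ::
  "nat \<Rightarrow> nat \<Rightarrow> (real list \<Rightarrow> real) \<Rightarrow> ('a event list \<Rightarrow> 'a set) \<Rightarrow> bool" where
  "tie_breaking k m t tie \<longleftrightarrow>
     (\<forall>h. k \<le> card (seen h) \<longrightarrow> is_top k (seen_grade m t h) (seen h) (tie h))"

text \<open>TA works in blocks of \<open>m\<close> accesses: a sorted access to list \<open>i\<close> yielding an object \<open>R\<close>, then
  random accesses for \<open>R\<close> to the other \<open>m - 1\<close> lists, even if these grades are already known.
  The \<open>m\<close> blocks \<open>i = 0, \<dots>, m - 1\<close> form one round of parallel sorted access, after which the
  stopping rule is tested. (On the empty history the test fails for \<open>k > 0\<close>.)\<close>

definition ta_action ::
  "nat \<Rightarrow> nat \<Rightarrow> (real list \<Rightarrow> real) \<Rightarrow> ('a event list \<Rightarrow> 'a set) \<Rightarrow> 'a event list \<Rightarrow> 'a action" where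
  "ta_action k m t tie h =
     (let i = length h div m mod m; q = length h mod m in
      if q = 0 then
        (if i = 0 \<and> ta_stops k m t h
         then Halt ((\<lambda>R. (R, seen_grade m t h R)) ` tie h)
         else Do_Sorted i)
      else
        (case h ! (length h - q) of
           Sorted_Event _ (Some (R, _)) \<Rightarrow> Do_Random R (filter (\<lambda>j. j \<noteq> i) [0..<m] ! (q - 1))
         | _ \<Rightarrow> Halt {}))  \<comment> \<open>never reached: TA stops before a list is exhausted\<close>"

definition TA ::
  "nat \<Rightarrow> nat \<Rightarrow> (real list \<Rightarrow> real) \<Rightarrow> ('a event list \<Rightarrow> 'a set) \<Rightarrow> 'a algorithm" where
  "TA k m t tie = (\<lambda>h. {ta_action k m t tie h})"

text \<open>For \<open>m = 1\<close> this ratio is \<open>1\<close>, but it is not a lower bound: TA then stops after at most \<open>k\<close>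
  sorted accesses on every database, so the additive constant allows even ratio \<open>0\<close>. Optimality of
  the ratio therefore needs \<open>m \<ge> 2\<close>.\<close>

definition ta_ratio :: "nat \<Rightarrow> real \<Rightarrow> real \<Rightarrow> real" where
  "ta_ratio m cS cR = real m + real m * (real m - 1) * cR / cS"

end

theory Submission
  imports Defs
begin

text \<open>
  Upper bound. Let an algorithm halt on \<open>D\<close> with answer set \<open>S\<close> after seeing \<open>a\<close> objects; its cost is
  at least \<open>a * cS\<close>, and a round of TA costs \<open>ta_ratio m cS cR * cS\<close>, so it suffices that TA stops by
  round \<open>a + k\<close>. If fewer than \<open>a + k + 1\<close> objects exist, TA has exhausted the lists. Otherwise some
  object \<open>V\<close> is neither seen nor in \<open>S\<close>. The algorithm cannot distinguish \<open>D\<close> from the database in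
  which \<open>V\<close> has, in every list, the grade last read there (1 if none), so every member of \<open>S\<close> reaches the
  algorithm's final threshold, hence TA's threshold of round \<open>a + k\<close>. If all of \<open>S\<close> was seen, TA has
  seen it too. If some \<open>R\<close> in \<open>S\<close> was not, then swapping \<open>R\<close> with any other unseen object goes
  unnoticed, so all unseen objects have the grade of \<open>R\<close>, and TA has seen at least \<open>k\<close> of them.

  Lower bound. Every list starts with the same \<open>k - 1\<close> objects of grade 1 everywhere, followed by
  \<open>n\<close> objects of grade 1 that belong to this list; the first \<open>d\<close> of them are candidates. An adversary
  gives each candidate a grade 0 in exactly one other list, and shows it only at the last possible
  random access. As long as one candidate is not fully probed, it may still have all grades 1, and
  the algorithm cannot halt. It must thus read \<open>n\<close> entries of one list or spend
  \<open>m * d\<close> sorted and \<open>m * (m - 1) * d\<close> random accesses, whereas \<open>d + k - 1\<close> sorted accesses to the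
  right list and \<open>k * m\<close> random accesses find and certify the top \<open>k\<close> answers.
\<close>

section \<open>Access histories\<close>

text \<open>The algorithm that permits every action reaches exactly the histories whose results fit
  \<open>D\<close>. This separates what a database answers from what an algorithm asks.\<close>

definition history_of :: "'a database \<Rightarrow> 'a event list \<Rightarrow> bool" where
  "history_of D h \<longleftrightarrow> reachable (\<lambda>_. UNIV) D h"

lemma reachable_snocD:
  assumes "reachable A D (h @ [e])"
  shows "reachable A D h \<and>
    ((\<exists>i. Do_Sorted i \<in> A h \<and> e = Sorted_Event i (sorted_result D h i)) \<or>
     (\<exists>R i. Do_Random R i \<in> A h \<and> e = Random_Event R i (random_result D R i)))"
  using assms by (cases rule: reachable.cases) auto

lemma reachable_appendD: "reachable A D (h @ g) \<Longrightarrow> reachable A D h"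
  by (induction g rule: rev_induct) (auto simp flip: append_assoc dest: reachable_snocD)

lemma reachable_imp_history_of: "reachable A D h \<Longrightarrow> history_of D h"
  unfolding history_of_def by (induction rule: reachable.induct) (auto intro: reachable.intros)

lemma history_of_Nil: "history_of D []"
  by (simp add: history_of_def reachable.start)

lemma history_of_snoc_Sorted:
  "history_of D (h @ [Sorted_Event i r]) \<longleftrightarrow> history_of D h \<and> r = sorted_result D h i"
  unfolding history_of_def by (auto dest: reachable_snocD intro: reachable.sorted_step)

lemma history_of_snoc_Random:
  "history_of D (h @ [Random_Event R i r]) \<longleftrightarrow> history_of D h \<and> r = random_result D R i"
  unfolding history_of_def by (auto dest: reachable_snocD intro: reachable.random_step)

lemmas history_of_simps = history_of_Nil history_of_snoc_Sorted history_of_snoc_Random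

text \<open>Actions depend on the history alone, so a run whose results also fit \<open>D'\<close>
  is a run on \<open>D'\<close>. Every indistinguishability argument below ends with this
  step.\<close>

lemma reachable_transfer:
  assumes "reachable A D h" and "history_of D' h"
  shows "reachable A D' h"
  using assms
proof (induction rule: reachable.induct)
  case (sorted_step h i)
  then show ?case
    by (metis history_of_snoc_Sorted reachable.sorted_step)
next
  case (random_step h R i)
  then show ?case
    by (metis history_of_snoc_Random reachable.random_step)
qed (rule reachable.start)

lemma entries_seen_append: "entries_seen i (g @ h) = entries_seen i g @ entries_seen i h"
  by (induction i g rule: entries_seen.induct) auto

lemma entries_seen_snoc_Sorted:
  "entries_seen i (h @ [Sorted_Event j r]) =
     entries_seen i h @ (case r of Some x \<Rightarrow> if j = i then [x] else [] | None \<Rightarrow> [])"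
  by (auto simp: entries_seen_append split: option.splits)

lemma entries_seen_snoc_Random: "entries_seen i (h @ [Random_Event R j r]) = entries_seen i h"
  by (auto simp: entries_seen_append)

lemma set_entries_seen: "set (entries_seen i h) = {x. Sorted_Event i (Some x) \<in> set h}"
  by (induction i h rule: entries_seen.induct) auto

lemma seen_eq: "seen h = {R. \<exists>i x. Sorted_Event i (Some (R, x)) \<in> set h}"
  by (force simp: seen_def set_entries_seen)

lemma seen_append: "seen (g @ h) = seen g \<union> seen h"
  by (auto simp: seen_eq)

lemma finite_seen: "finite (seen h)"
proof -
  have "seen h \<subseteq> (\<lambda>e. case e of Sorted_Event i (Some (R, x)) \<Rightarrow> R | _ \<Rightarrow> undefined) ` set h"
    by (force simp: seen_eq)
  then show ?thesis
    by (rule finite_subset) simp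
qed

lemma history_of_entries_seen_take:
  assumes "history_of D h"
  shows "\<exists>n. entries_seen i h = (if i < length D then take n (D ! i) else []) \<and>
    (i < length D \<longrightarrow> n \<le> length (D ! i))"
  using assms
proof (induction h rule: rev_induct)
  case (snoc e h)
  show ?case
  proof (cases e)
    case (Sorted_Event j r)
    with snoc.prems have r: "r = sorted_result D h j" and "history_of D h"
      by (simp_all add: history_of_simps)
    then obtain n where n: "entries_seen i h = (if i < length D then take n (D ! i) else [])"
        "i < length D \<longrightarrow> n \<le> length (D ! i)"
      using snoc.IH by blast
    show ?thesis
    proof (cases "j = i \<and> i < length D \<and> n < length (D ! i)")
      case True
      then have "entries_seen i (h @ [e]) = take (Suc n) (D ! i)"
        by (simp add: Sorted_Event entries_seen_snoc_Sorted r sorted_result_def n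
            take_Suc_conv_app_nth)
      then show ?thesis
        using True by (intro exI[of _ "Suc n"]) simp
    next
      case False
      then have "entries_seen i (h @ [e]) = entries_seen i h"
        using n by (auto simp: Sorted_Event entries_seen_snoc_Sorted r sorted_result_def Let_def)
      then show ?thesis
        using n by metis
    qed
  next
    case (Random_Event R j r)
    with snoc show ?thesis
      by (simp add: history_of_simps entries_seen_snoc_Random)
  qed
qed (auto intro: exI[of _ 0])

lemma history_of_length_entries_seen:
  assumes "history_of D h" and "i < length D"
  shows "length (entries_seen i h) \<le> length (D ! i)"
  using history_of_entries_seen_take[OF assms(1), of i] assms(2) by auto

lemma history_of_entries_seen:
  assumes "history_of D h"
  shows "entries_seen i h =
    (if i < length D then take (length (entries_seen i h)) (D ! i) else [])"
  using history_of_entries_seen_take[OF assms(1), of i] by auto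

lemma history_of_events:
  assumes "history_of D h"
  shows history_of_Sorted_Event:
      "Sorted_Event i (Some x) \<in> set h \<Longrightarrow> i < length D \<and> x \<in> set (D ! i)"
    and history_of_Random_Event: "Random_Event R i r \<in> set h \<Longrightarrow> r = random_result D R i"
proof -
  show "i < length D \<and> x \<in> set (D ! i)" if "Sorted_Event i (Some x) \<in> set h"
  proof -
    have "x \<in> set (entries_seen i h)"
      using that by (simp add: set_entries_seen)
    then show ?thesis
      using history_of_entries_seen_take[OF assms, of i]
      by (auto split: if_splits dest: in_set_takeD)
  qed
  show "r = random_result D R i" if "Random_Event R i r \<in> set h"
    using assms that
  proof (induction h rule: rev_induct)
    case (snoc e h)
    then show ?case
      by (cases e) (auto simp: history_of_simps)
  qed simp
qed

text \<open>A history exposes only the prefixes read under sorted access and the probed grades. List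
  lengths must agree too, since a \<open>None\<close> reveals the end of a list.\<close>

lemma history_of_cong:
  assumes "history_of D h" and len: "length D' = length D"
    and lens: "\<And>i. i < length D \<Longrightarrow> length (D' ! i) = length (D ! i)"
    and "\<And>i. i < length D \<Longrightarrow>
      take (length (entries_seen i h)) (D' ! i) = take (length (entries_seen i h)) (D ! i)"
    and "\<And>R i r. Random_Event R i r \<in> set h \<Longrightarrow> random_result D' R i = random_result D R i"
  shows "history_of D' h"
  using assms(1,4,5)
proof (induction h rule: rev_induct)
  case (snoc e h)
  have "take (length (entries_seen i h)) (D' ! i) = take (length (entries_seen i h)) (D ! i)"
    if "i < length D" for i
  proof -
    have "length (entries_seen i h) \<le> length (entries_seen i (h @ [e]))"
      by (simp add: entries_seen_append)
    then show ?thesis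
      using arg_cong[OF snoc.prems(2)[OF that], of "take (length (entries_seen i h))"]
      by (simp add: min_absorb1)
  qed
  moreover have "history_of D h"
    using snoc.prems(1) by (cases e) (simp_all add: history_of_simps)
  ultimately have IH: "history_of D' h"
    using snoc.IH snoc.prems(3) by auto
  show ?case
  proof (cases e)
    case (Sorted_Event j r)
    then have r: "r = sorted_result D h j"
      using snoc.prems(1) by (simp add: history_of_simps)
    have "sorted_result D' h j = sorted_result D h j"
    proof (cases "j < length D \<and> length (entries_seen j h) < length (D ! j)")
      case True
      let ?n = "length (entries_seen j h)"
      have "length (entries_seen j (h @ [e])) = Suc ?n"
        using True by (simp add: Sorted_Event entries_seen_snoc_Sorted r sorted_result_def)
      then have "take (Suc ?n) (D' ! j) = take (Suc ?n) (D ! j)"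
        using snoc.prems(2)[of j] True by simp
      then have "D' ! j ! ?n = D ! j ! ?n"
        by (metis lessI nth_take)
      then show ?thesis
        using True len lens by (simp add: sorted_result_def)
    next
      case False
      then show ?thesis
        using len lens by (auto simp: sorted_result_def Let_def)
    qed
    then show ?thesis
      using IH r by (simp add: Sorted_Event history_of_simps)
  next
    case (Random_Event R j r)
    then have "r = random_result D R j"
      using snoc.prems(1) by (simp add: history_of_simps)
    moreover have "random_result D' R j = random_result D R j"
      using snoc.prems(3)[of R j r] by (simp add: Random_Event)
    ultimately show ?thesis
      using IH by (simp add: Random_Event history_of_simps)
  qed
qed (simp add: history_of_simps)

text \<open>Seen objects stay seen, so no recorded random access can expose a change to the grades
  of an object that is still unseen.\<close>

lemma no_wild_guesses_Random_seen:
  assumes "no_wild_guesses k m A" and "D \<in> databases k m" and "reachable A D h"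
    and "Random_Event R i r \<in> set h"
  shows "R \<in> seen h"
  using assms(3,4)
proof (induction rule: reachable.induct)
  case (random_step h R' i')
  then show ?case
    using assms(1,2) by (auto simp: no_wild_guesses_def seen_append)
qed (auto simp: seen_append)

section \<open>Costs of histories and of algorithms\<close>

abbreviation history_cost :: "real \<Rightarrow> real \<Rightarrow> 'a event list \<Rightarrow> real" where
  "history_cost cS cR h \<equiv> sum_list (map (event_cost cS cR) h)"

text \<open>A set, so that repeated random accesses count once and its cardinality bounds their
  number from below.\<close>

definition probes :: "'a event list \<Rightarrow> ('a \<times> nat) set" where
  "probes h = {(R, i). \<exists>r. Random_Event R i r \<in> set h}"

lemma finite_probes: "finite (probes h)"
proof -
  have "probes h \<subseteq> (\<lambda>e. case e of Random_Event R i r \<Rightarrow> (R, i) | _ \<Rightarrow> undefined) ` set h"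
    by (force simp: probes_def)
  then show ?thesis
    by (rule finite_subset) simp
qed

lemma history_cost_nonneg:
  fixes cS cR :: real and h :: "'a event list"
  assumes "cS \<ge> 0" and "cR \<ge> 0"
  shows "0 \<le> history_cost cS cR h"
proof (rule sum_list_nonneg)
  fix x assume "x \<in> set (map (event_cost cS cR) h)"
  then obtain e :: "'a event" where "x = event_cost cS cR e"
    by auto
  with assms show "0 \<le> x"
    by (cases e) auto
qed

text \<open>Each sorted access adds at most one seen object, each random access at most one
  probe.\<close>

lemma history_cost_ge:
  fixes cS cR :: real
  assumes "cS \<ge> 0" and "cR \<ge> 0"
  shows "cS * card (seen h) + cR * card (probes h) \<le> history_cost cS cR h"
proof (induction h)
  case Nil
  then show ?case by (simp add: seen_eq probes_def)
next
  case (Cons e h)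
  show ?case
  proof (cases e)
    case (Sorted_Event i r)
    have p: "probes (e # h) = probes h"
      by (auto simp: probes_def Sorted_Event)
    obtain R where "seen (e # h) \<subseteq> insert R (seen h)"
    proof (cases r)
      case None
      then have "seen (e # h) = seen h"
        by (auto simp: seen_eq Sorted_Event)
      then show ?thesis using that by blast
    next
      case (Some x)
      then have "seen (e # h) \<subseteq> insert (fst x) (seen h)"
        by (auto simp: seen_eq Sorted_Event)
      then show ?thesis using that by blast
    qed
    then have "card (seen (e # h)) \<le> Suc (card (seen h))"
      using card_mono[of "insert R (seen h)" "seen (e # h)"] finite_seen[of h]
      by (simp add: card_insert_if split: if_splits)
    then have "cS * card (seen (e # h)) \<le> cS * Suc (card (seen h))"
      using assms by (intro mult_left_mono) auto
    also have "\<dots> = cS * card (seen h) + cS"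
      by (simp add: algebra_simps)
    finally show ?thesis
      using Cons by (simp add: p) (simp add: Sorted_Event)
  next
    case (Random_Event R i r)
    have s: "seen (e # h) = seen h"
      by (auto simp: seen_eq Random_Event)
    have "probes (e # h) = insert (R, i) (probes h)"
      by (auto simp: probes_def Random_Event)
    then have "card (probes (e # h)) \<le> Suc (card (probes h))"
      by (simp add: card_insert_if finite_probes)
    then have "cR * card (probes (e # h)) \<le> cR * Suc (card (probes h))"
      using assms by (intro mult_left_mono) auto
    also have "\<dots> = cR * card (probes h) + cR"
      by (simp add: algebra_simps)
    finally show ?thesis
      using Cons by (simp add: s) (simp add: Random_Event)
  qed
qed

lemma middleware_cost_le:
  assumes "cS \<ge> 0" and "cR \<ge> 0" and "halts_with A D h Y"
  shows "middleware_cost cS cR A D \<le> history_cost cS cR h"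
  unfolding middleware_cost_def using assms
  by (intro cInf_lower bdd_belowI[of _ 0]) (auto intro!: history_cost_nonneg)

text \<open>Correctness supplies a halting history, so the infimum is taken over a nonempty
  set.\<close>

lemma middleware_cost_ge:
  assumes "correct k m t A" and "D \<in> databases k m"
    and "\<And>h Y. halts_with A D h Y \<Longrightarrow> b \<le> history_cost cS cR h"
  shows "b \<le> middleware_cost cS cR A D"
  unfolding middleware_cost_def
proof (rule cInf_greatest)
  obtain h Y where "halts_with A D h Y"
    using assms(1,2) unfolding correct_def by blast
  then show "{history_cost cS cR h | h. \<exists>Y. halts_with A D h Y} \<noteq> {}"
    by blast
qed (use assms(3) in blast)

text \<open>There is only one branch, and it cannot go on after \<open>Halt\<close>. This gives
  uniqueness of TA's run, and it lets the cost of a partial run bound the total cost from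
  below.\<close>

lemma deterministic_halt_extends:
  assumes "deterministic A" and "reachable A D h" and "halts_with A D g Y"
  shows "\<exists>g'. g = h @ g'"
  using assms(2)
proof (induction rule: reachable.induct)
  case start
  then show ?case by simp
next
  \<comment> \<open>Common core of both kinds of access: \<open>a\<close> is the only action at
    \<open>h\<close> and is not \<open>Halt\<close>, so \<open>g\<close> is longer than
    \<open>h\<close> and continues with \<open>e\<close>.\<close>
  have step: "\<exists>g'. g = (h @ [e]) @ g'"
    if h: "\<exists>g'. g = h @ g'" and act: "a \<in> A h" "\<And>Z. a \<noteq> Halt Z"
      and ev: "\<And>i. a = Do_Sorted i \<Longrightarrow> e = Sorted_Event i (sorted_result D h i)"
        "\<And>R i. a = Do_Random R i \<Longrightarrow> e = Random_Event R i (random_result D R i)"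
    for h e a
  proof -
    obtain g' where g: "g = h @ g'"
      using h by blast
    have Ah: "A h = {a}"
      using assms(1) act(1) by (metis deterministic_def is_singleton_def singletonD)
    show ?thesis
    proof (cases g')
      case Nil
      then show ?thesis
        using g assms(3) Ah act(2) by (auto simp: halts_with_def)
    next
      case (Cons e' g'')
      then have "reachable A D (h @ [e'])"
        using g assms(3) reachable_appendD[of A D "h @ [e']" g''] by (simp add: halts_with_def)
      then have "e' = e"
        using reachable_snocD[of A D h e'] Ah ev by auto
      then show ?thesis
        using g Cons by simp
    qed
  qed
  {
    case (sorted_step h i)
    show ?case
      by (rule step[OF sorted_step.IH sorted_step.hyps(2)]) simp_all
  next
    case (random_step h R i)
    show ?case
      by (rule step[OF random_step.IH random_step.hyps(2)]) simp_all
  }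
qed

section \<open>Databases and one round of TA\<close>

lemma databasesD:
  assumes "D \<in> databases k m"
  shows "length D = m" and "k \<le> card (objects D)"
    and "i < m \<Longrightarrow> distinct (map fst (D ! i))"
    and "i < m \<Longrightarrow> fst ` set (D ! i) = objects D"
    and "i < m \<Longrightarrow> snd ` set (D ! i) \<subseteq> {0..1}"
    and "i < m \<Longrightarrow> sorted_wrt (\<ge>) (map snd (D ! i))"
  using assms by (simp_all add: databases_def)

lemma databasesI:
  assumes "length D = m" and "m \<ge> 1" and "k \<le> card X"
    and "\<And>i. i < m \<Longrightarrow> distinct (map fst (D ! i))"
    and X: "\<And>i. i < m \<Longrightarrow> fst ` set (D ! i) = X"
    and "\<And>i. i < m \<Longrightarrow> snd ` set (D ! i) \<subseteq> {0..1}"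
    and "\<And>i. i < m \<Longrightarrow> sorted_wrt (\<ge>) (map snd (D ! i))"
  shows "D \<in> databases k m" and "objects D = X"
proof -
  have all: "\<exists>i<m. L = D ! i" if "L \<in> set D" for L
    using that assms(1) by (metis in_set_conv_nth)
  have "fst ` set L = X" if "L \<in> set D" for L
    using all[OF that] X by blast
  moreover have "set D \<noteq> {}"
    using assms(1,2) by auto
  ultimately show obj: "objects D = X"
    unfolding objects_def by simp
  have "distinct (map fst L) \<and> fst ` set L = objects D \<and> snd ` set L \<subseteq> {0..1} \<and>
      sorted_wrt (\<ge>) (map snd L)" if L: "L \<in> set D" for L
  proof -
    obtain i where "i < m" "L = D ! i"
      using all[OF L] by blast
    then show ?thesis
      using assms(4-7)[of i] obj by simp
  qed
  then show "D \<in> databases k m"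
    using assms(1,3) obj by (simp add: databases_def)
qed

lemma databases_length_list:
  assumes "D \<in> databases k m" and "i < m"
  shows "length (D ! i) = card (objects D)"
  using databasesD(3,4)[OF assms] by (metis distinct_card length_map set_map)

lemma databases_map_of:
  assumes "D \<in> databases k m" and "i < m"
  shows "map_of (D ! i) R = Some x \<longleftrightarrow> (R, x) \<in> set (D ! i)"
  using databasesD(3)[OF assms] by simp

lemma databases_objects_iff:
  assumes "D \<in> databases k m" and "i < m"
  shows "R \<in> objects D \<longleftrightarrow> (\<exists>x. (R, x) \<in> set (D ! i))"
  using databasesD(4)[OF assms] by force

lemma finite_objects: "finite (objects D)"
  by (auto simp: objects_def)

lemma overall_grade_eq:
  assumes "length D = m"
  shows "overall_grade t D R = t (map (\<lambda>i. the (map_of (D ! i) R)) [0..<m])"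
proof -
  have "map (\<lambda>L. the (map_of L R)) D = map (\<lambda>L. the (map_of L R)) (map ((!) D) [0..<m])"
    using assms map_nth by metis
  then show ?thesis
    by (simp add: overall_grade_def comp_def)
qed

lemma grade_in_unit_interval:
  assumes "D \<in> databases k m" and "R \<in> objects D" and "i < m"
  shows "the (map_of (D ! i) R) \<in> {0..1}"
proof -
  obtain x where x: "(R, x) \<in> set (D ! i)"
    using databases_objects_iff[OF assms(1,3)] assms(2) by blast
  then have "map_of (D ! i) R = Some x"
    using databases_map_of[OF assms(1,3)] by blast
  then show ?thesis
    using x databasesD(5)[OF assms(1,3)] by force
qed

lemma map_in_unit_cube: "map g [0..<m] \<in> unit_cube m \<longleftrightarrow> (\<forall>i<m. g i \<in> {0..1})"
  by (auto simp: unit_cube_def image_subset_iff)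

lemma history_of_objects:
  assumes "D \<in> databases k m" and "history_of D h"
  shows "seen h \<subseteq> objects D"
proof
  fix R assume "R \<in> seen h"
  then obtain i x where "Sorted_Event i (Some (R, x)) \<in> set h"
    by (auto simp: seen_eq)
  then show "R \<in> objects D"
    using history_of_Sorted_Event[OF assms(2)] databases_objects_iff[OF assms(1)]
      databasesD(1)[OF assms(1)] by blast
qed

lemma monotone_aggregationD:
  assumes "monotone_aggregation m t"
    and "\<And>i. i < m \<Longrightarrow> f i \<in> {0..1}" and "\<And>i. i < m \<Longrightarrow> g i \<in> {0..1}"
    and "\<And>i. i < m \<Longrightarrow> f i \<le> g i"
  shows "t (map f [0..<m]) \<le> t (map g [0..<m])"
  using assms unfolding monotone_aggregation_def
  by (simp add: Ball_def map_in_unit_cube)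

section \<open>The run of TA written out explicitly\<close>

definition block :: "'a database \<Rightarrow> nat \<Rightarrow> 'a \<times> real \<Rightarrow> 'a event list" where
  "block D i e = Sorted_Event i (Some e) #
     map (\<lambda>j. Random_Event (fst e) j (random_result D (fst e) j))
       (filter (\<lambda>j. j \<noteq> i) [0..<length D])"

text \<open>\<open>p\<close> is the depth of the round and \<open>c\<close> the number of lists
  already served in it, so unfinished rounds can appear in inductions.\<close>

definition blocks :: "'a database \<Rightarrow> nat \<Rightarrow> nat \<Rightarrow> 'a event list" where
  "blocks D p c = concat (map (\<lambda>i. block D i (D ! i ! p)) [0..<c])"

definition rounds :: "'a database \<Rightarrow> nat \<Rightarrow> 'a event list" where
  "rounds D r = concat (map (\<lambda>p. blocks D p (length D)) [0..<r])"

lemma length_filter_neq: "i < m \<Longrightarrow> length (filter (\<lambda>j. j \<noteq> i) [0..<m]) = m - 1"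
proof -
  assume "i < m"
  have "length (filter (\<lambda>j. j \<noteq> i) [0..<m]) = card (set (filter (\<lambda>j. j \<noteq> i) [0..<m]))"
    by (intro distinct_card[symmetric]) simp
  also have "set (filter (\<lambda>j. j \<noteq> i) [0..<m]) = {0..<m} - {i}"
    by auto
  finally show ?thesis
    using \<open>i < m\<close> by simp
qed

lemma length_block: "i < length D \<Longrightarrow> length (block D i e) = length D"
  by (simp add: block_def length_filter_neq)

lemma blocks_0: "blocks D p 0 = []"
  and blocks_Suc: "blocks D p (Suc c) = blocks D p c @ block D c (D ! c ! p)"
  by (simp_all add: blocks_def)

lemma rounds_0: "rounds D 0 = []"
  and rounds_Suc: "rounds D (Suc r) = rounds D r @ blocks D r (length D)"
  by (simp_all add: rounds_def)

lemma length_blocks: "c \<le> length D \<Longrightarrow> length (blocks D p c) = c * length D"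
  by (induction c) (simp_all add: blocks_0 blocks_Suc length_block)

lemma length_rounds: "length (rounds D r) = r * length D * length D"
  by (induction r) (simp_all add: rounds_0 rounds_Suc length_blocks algebra_simps)

lemma history_cost_rounds:
  fixes cS cR :: real
  shows "history_cost cS cR (rounds D r) =
    real r * (real (length D) * (cS + real (length D - 1) * cR))"
proof -
  have b: "history_cost cS cR (block D i e) = cS + real (length D - 1) * cR"
    if "i < length D" for i e
    using that by (simp add: block_def comp_def sum_list_triv length_filter_neq)
  have "history_cost cS cR (blocks D p c) = real c * (cS + real (length D - 1) * cR)"
    if "c \<le> length D" for p c
    using that by (induction c) (simp_all add: blocks_0 blocks_Suc b algebra_simps)
  then show ?thesis
    by (induction r) (simp_all add: rounds_0 rounds_Suc algebra_simps)
qed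

lemma entries_seen_block: "entries_seen j (block D i e) = (if j = i then [e] else [])"
proof -
  have "entries_seen l (map (\<lambda>j. Random_Event (fst e) j (random_result D (fst e) j)) js) = []"
    for l js by (induction js) simp_all
  then show ?thesis
    by (simp add: block_def)
qed

lemma entries_seen_blocks: "entries_seen j (blocks D p c) = (if j < c then [D ! j ! p] else [])"
  by (induction c) (auto simp: blocks_0 blocks_Suc entries_seen_append entries_seen_block)

lemma entries_seen_rounds:
  "entries_seen j (rounds D r) = (if j < length D then map ((!) (D ! j)) [0..<r] else [])"
  by (induction r) (simp_all add: rounds_0 rounds_Suc entries_seen_append entries_seen_blocks)

lemma map_nth_upt: "r \<le> length xs \<Longrightarrow> map ((!) xs) [0..<r] = take r xs"
  by (rule nth_equalityI) auto

lemma deterministic_TA: "deterministic (TA k m t tie)"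
  by (simp add: deterministic_def TA_def)

text \<open>The probed object is taken from the sorted event that opened the current block.\<close>

lemma no_wild_guesses_TA:
  assumes "m \<ge> 1"
  shows "no_wild_guesses k m (TA k m t tie)"
  unfolding no_wild_guesses_def
proof (intro ballI allI impI, elim conjE)
  fix D :: "'a database" and h R i
  assume "Do_Random R i \<in> TA k m t tie h"
  then have act: "ta_action k m t tie h = Do_Random R i"
    by (simp add: TA_def)
  define q where "q = length h mod m"
  have q: "q \<noteq> 0"
    using act by (auto simp: ta_action_def Let_def q_def split: if_splits)
  obtain i' x where "h ! (length h - q) = Sorted_Event i' (Some (R, x))"
    using act q by (auto simp: ta_action_def Let_def q_def split: event.splits option.splits)
  moreover have "length h - q < length h"
    using q by (metis diff_less gr0I length_0_conv length_greater_0_conv mod_0 q_def)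
  ultimately show "R \<in> seen h"
    unfolding seen_eq by (metis (mono_tags, lifting) mem_Collect_eq nth_mem)
qed

text \<open>\<open>n\<close> counts the finished blocks, so \<open>n mod m\<close> is the list to be
  served. Within the block, \<open>length h mod m\<close> counts its accesses so far; the induction
  follows the random accesses in the order that both \<open>ta_action\<close> and
  \<open>block\<close> use.\<close>

lemma TA_block:
  assumes "i < m" and "length D = m" and "length h = n * m" and "n mod m = i"
    and "reachable (TA k m t tie) D h" and "\<not> (i = 0 \<and> ta_stops k m t h)"
    and "sorted_result D h i = Some e"
  shows "reachable (TA k m t tie) D (h @ block D i e)"
proof -
  let ?js = "filter (\<lambda>j. j \<noteq> i) [0..<m]"
  let ?ev = "\<lambda>j. Random_Event (fst e) j (random_result D (fst e) j)"
  have "reachable (TA k m t tie) D (h @ Sorted_Event i (Some e) # map ?ev (take s ?js))"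
    if "s \<le> m - 1" for s
    using that
  proof (induction s)
    case 0
    have "ta_action k m t tie h = Do_Sorted i"
      using assms(1-4,6) by (auto simp: ta_action_def Let_def)
    then have "Do_Sorted i \<in> TA k m t tie h"
      by (simp add: TA_def)
    then show ?case
      using reachable.sorted_step[OF assms(5), of i] assms(7) by simp
  next
    case (Suc s)
    let ?h = "h @ Sorted_Event i (Some e) # map ?ev (take s ?js)"
    have js: "length ?js = m - 1"
      using assms(1) by (rule length_filter_neq)
    have len: "length ?h = n * m + Suc s"
      using Suc.prems by (simp add: assms(3) js)
    have "Suc s < m"
      using Suc.prems by simp
    then have md: "length ?h mod m = Suc s"
      unfolding len by (simp only: mod_mult_self3 mod_less)
    have "(n * m + Suc s) div m = n"
      using \<open>Suc s < m\<close> by (intro div_nat_eqI) simp_all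
    then have dv: "length ?h div m mod m = i"
      unfolding len using assms(4) by simp
    have "length ?h - Suc s = length h"
      unfolding len using assms(3) by simp
    then have "?h ! (length ?h - Suc s) = Sorted_Event i (Some e)"
      by (metis nth_append_length)
    then have "ta_action k m t tie ?h = Do_Random (fst e) (?js ! s)"
      unfolding ta_action_def Let_def md dv by (simp split: prod.splits)
    then have "Do_Random (fst e) (?js ! s) \<in> TA k m t tie ?h"
      by (simp add: TA_def)
    from reachable.random_step[OF Suc.IH this]
    have "reachable (TA k m t tie) D (?h @ [?ev (?js ! s)])"
      using Suc.prems by simp
    moreover have "take (Suc s) ?js = take s ?js @ [?js ! s]"
      using Suc.prems js by (intro take_Suc_conv_app_nth) simp
    ultimately show ?case
      by simp
  qed
  from this[of "m - 1"] show ?thesis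
    using length_filter_neq[OF assms(1)] by (simp add: block_def assms(2))
qed

section \<open>Correctness of TA\<close>

lemma databases_sorted_nth:
  assumes "D \<in> databases k m" and "i < m" and "p \<le> q" and "q < length (D ! i)"
  shows "snd (D ! i ! q) \<le> snd (D ! i ! p)"
proof (cases "p = q")
  case False
  then show ?thesis
    using sorted_wrt_nth_less[OF databasesD(6)[OF assms(1,2)], of p q] assms(3,4) by simp
qed simp

lemma databases_unread_le:
  assumes "D \<in> databases k m" and "i < m" and "(R, x) \<in> set (D ! i)"
    and "R \<notin> fst ` set (take n (D ! i))" and "p < n"
  shows "x \<le> snd (D ! i ! p)"
proof -
  obtain q where q: "q < length (D ! i)" "D ! i ! q = (R, x)"
    using assms(3) by (metis in_set_conv_nth)
  have "n \<le> q"
  proof (rule ccontr)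
    assume "\<not> n \<le> q"
    then have "(R, x) \<in> set (take n (D ! i))"
      using q by (auto simp: in_set_conv_nth intro!: exI[of _ q])
    then show False
      using assms(4) by force
  qed
  then show ?thesis
    using databases_sorted_nth[OF assms(1,2), of p q] q assms(5) by simp
qed

text \<open>The entries of one list belong to distinct objects. The number of seen objects, which is
  what the cost pays for, thus bounds the depth reached in each list.\<close>

lemma length_entries_seen_le_card_seen:
  assumes D: "D \<in> databases k m" and "history_of D h"
  shows "length (entries_seen i h) \<le> card (seen h)"
proof (cases "i < m")
  case True
  obtain n where "entries_seen i h = take n (D ! i)"
    using history_of_entries_seen_take[OF assms(2), of i] True databasesD(1)[OF D] by auto
  then have "distinct (map fst (entries_seen i h))"
    using databasesD(3)[OF D True] by (simp add: take_map[symmetric])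
  then have "length (entries_seen i h) = card (fst ` set (entries_seen i h))"
    using distinct_card by fastforce
  also have "\<dots> \<le> card (seen h)"
    by (rule card_mono[OF finite_seen]) (auto simp: seen_def)
  finally show ?thesis .
next
  case False
  then show ?thesis
    using history_of_entries_seen_take[OF assms(2), of i] databasesD(1)[OF D] by simp
qed

section \<open>A fixed database: grades, threshold and halting of TA\<close>

locale ranked_database =
  fixes k m :: nat and t :: "real list \<Rightarrow> real" and D :: "'a database"
  assumes D: "D \<in> databases k m" and k: "k \<ge> 1" and m: "m \<ge> 1"
    and mono: "monotone_aggregation m t"
begin

abbreviation "N \<equiv> card (objects D)"
abbreviation "grade \<equiv> overall_grade t D"

lemmas length_D = databasesD(1)[OF D]

lemma N_pos: "N \<ge> 1"
  using databasesD(2)[OF D] k by simp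

lemma entries_rounds:
  assumes "j < m" and "r \<le> N"
  shows "entries_seen j (rounds D r) = take r (D ! j)"
  using assms databases_length_list[OF D]
  by (simp add: entries_seen_rounds length_D map_nth_upt)

lemma seen_rounds:
  assumes "r \<le> N"
  shows "seen (rounds D r) = (\<Union>j<m. fst ` set (take r (D ! j)))"
proof -
  have "entries_seen j (rounds D r) = (if j < m then take r (D ! j) else [])" for j
    using entries_rounds[of j r] assms by (simp add: entries_seen_rounds length_D)
  then show ?thesis
    by (auto simp: seen_def split: if_splits)
qed

lemma rounds_Random_Event:
  "Random_Event R i v \<in> set (rounds D r) \<Longrightarrow> v = random_result D R i"
  by (auto simp: rounds_def blocks_def block_def)

lemma rounds_Sorted_Event:
  assumes "Sorted_Event i (Some e) \<in> set (rounds D r)" and "r \<le> N"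
  shows "i < m" and "e \<in> set (D ! i)"
proof -
  have "e \<in> set (entries_seen i (rounds D r))"
    using assms(1) by (simp add: set_entries_seen)
  moreover from this show "i < m"
    by (simp add: entries_seen_rounds length_D split: if_splits)
  ultimately show "e \<in> set (D ! i)"
    using entries_rounds[of i r] assms(2) by (auto dest: in_set_takeD)
qed

text \<open>The list \<open>j\<close> in which \<open>R\<close> surfaced supplies its own grade, and
  the random accesses of that block supply all others.\<close>

lemma rounds_retrieve:
  assumes "R \<in> seen (rounds D r)" and "i < m" and "r \<le> N"
  shows "Sorted_Event i (Some (R, the (map_of (D ! i) R))) \<in> set (rounds D r) \<or>
    Random_Event R i (Some (the (map_of (D ! i) R))) \<in> set (rounds D r)"
proof -
  obtain j x where ev: "Sorted_Event j (Some (R, x)) \<in> set (rounds D r)"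
    using assms(1) by (auto simp: seen_eq)
  note jx = rounds_Sorted_Event[OF ev assms(3)]
  show ?thesis
  proof (cases "i = j")
    case True
    then show ?thesis
      using ev jx databases_map_of[OF D, of j R x] by simp
  next
    case False
    obtain p where p: "p < r" "Sorted_Event j (Some (R, x)) \<in> set (blocks D p m)"
      using ev by (auto simp: rounds_def length_D)
    then have "D ! j ! p = (R, x)"
      by (auto simp: blocks_def block_def)
    then have "Random_Event R i (random_result D R i) \<in> set (block D j (D ! j ! p))"
      using assms(2) False by (simp add: block_def length_D)
    then have "Random_Event R i (random_result D R i) \<in> set (blocks D p m)"
      using jx(1) unfolding blocks_def by (simp add: Bex_def) blast
    then have "Random_Event R i (random_result D R i) \<in> set (rounds D r)"
      using p(1) by (auto simp: rounds_def length_D)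
    moreover have "R \<in> objects D"
      using jx databases_objects_iff[OF D] by blast
    then obtain y where "(R, y) \<in> set (D ! i)"
      using databases_objects_iff[OF D assms(2)] by blast
    ultimately show ?thesis
      using databases_map_of[OF D assms(2), of R y] assms(2)
      by (simp add: random_result_def length_D)
  qed
qed

lemma seen_grade_rounds:
  assumes "R \<in> seen (rounds D r)" and "r \<le> N"
  shows "seen_grade m t (rounds D r) R = grade R"
proof -
  \<comment> \<open>The definite description is justified: some event reports this grade, and all
    events about it agree with \<open>D\<close>.\<close>
  have "retrieved_grade (rounds D r) R i = the (map_of (D ! i) R)" if "i < m" for i
    unfolding retrieved_grade_def
  proof (rule the_equality)
    show "Sorted_Event i (Some (R, the (map_of (D ! i) R))) \<in> set (rounds D r) \<or>
        Random_Event R i (Some (the (map_of (D ! i) R))) \<in> set (rounds D r)"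
      by (rule rounds_retrieve[OF assms(1) that assms(2)])
    fix x
    assume "Sorted_Event i (Some (R, x)) \<in> set (rounds D r) \<or>
      Random_Event R i (Some x) \<in> set (rounds D r)"
    then have "map_of (D ! i) R = Some x"
    proof
      assume "Sorted_Event i (Some (R, x)) \<in> set (rounds D r)"
      then show ?thesis
        using rounds_Sorted_Event(2)[OF _ assms(2)] databases_map_of[OF D that] by blast
    next
      assume "Random_Event R i (Some x) \<in> set (rounds D r)"
      then show ?thesis
        using rounds_Random_Event that by (fastforce simp: random_result_def length_D)
    qed
    then show "x = the (map_of (D ! i) R)"
      by simp
  qed
  then have "map (retrieved_grade (rounds D r) R) [0..<m] =
      map (\<lambda>i. the (map_of (D ! i) R)) [0..<m]"
    by simp
  then show ?thesis
    unfolding seen_grade_def overall_grade_eq[OF length_D] by (rule arg_cong)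
qed

text \<open>Positions count from 0, so the last entries read have index \<open>r - 1\<close>;
  \<open>r \<ge> 1\<close> makes the read prefixes nonempty.\<close>

lemma threshold_rounds:
  assumes "r \<ge> 1" and "r \<le> N"
  shows "threshold m t (rounds D r) = t (map (\<lambda>i. snd (D ! i ! (r - 1))) [0..<m])"
proof -
  have "last (entries_seen i (rounds D r)) = D ! i ! (r - 1)" if "i < m" for i
    using assms that
    by (simp add: entries_seen_rounds length_D last_conv_nth)
  then have "map (\<lambda>i. snd (last (entries_seen i (rounds D r)))) [0..<m] =
      map (\<lambda>i. snd (D ! i ! (r - 1))) [0..<m]"
    by simp
  then show ?thesis
    unfolding threshold_def by (rule arg_cong)
qed

lemma ta_stops_rounds:
  assumes "r \<le> N"
  shows "ta_stops k m t (rounds D r) \<longleftrightarrow>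
    k \<le> card {R \<in> seen (rounds D r). threshold m t (rounds D r) \<le> grade R}"
proof -
  have "{R \<in> seen (rounds D r). threshold m t (rounds D r) \<le> seen_grade m t (rounds D r) R} =
      {R \<in> seen (rounds D r). threshold m t (rounds D r) \<le> grade R}"
    using seen_grade_rounds assms by auto
  then show ?thesis
    by (simp add: ta_stops_def)
qed

lemma sorted_grade_in_unit_interval:
  assumes "i < m" and "p < N"
  shows "snd (D ! i ! p) \<in> {0..1}"
  using databasesD(5)[OF D assms(1)] databases_length_list[OF D assms(1)] assms(2)
  by (metis image_subset_iff nth_mem)

text \<open>At full depth the threshold is built from the smallest grade of each list, so by
  monotonicity every object reaches it. This makes TA terminate.\<close>

lemma ta_stops_at_N: "ta_stops k m t (rounds D N)"
proof -
  have full: "take N (D ! j) = D ! j" if "j < m" for j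
    using databases_length_list[OF D that] by simp
  have "seen (rounds D N) = (\<Union>j<m. fst ` set (take N (D ! j)))"
    by (rule seen_rounds) simp
  also have "\<dots> = (\<Union>j<m. objects D)"
    using full databasesD(4)[OF D] by (intro SUP_cong) auto
  also have "\<dots> = objects D"
    using m by (auto simp: lessThan_empty_iff)
  finally have seen: "seen (rounds D N) = objects D" .
  have "threshold m t (rounds D N) \<le> grade R" if R: "R \<in> objects D" for R
  proof -
    have "snd (D ! i ! (N - 1)) \<le> the (map_of (D ! i) R)" if i: "i < m" for i
    proof -
      obtain x where x: "(R, x) \<in> set (D ! i)"
        using databases_objects_iff[OF D i] R by blast
      then obtain p where "p < length (D ! i)" "D ! i ! p = (R, x)"
        by (metis in_set_conv_nth)
      moreover have "map_of (D ! i) R = Some x"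
        using x databases_map_of[OF D i] by blast
      ultimately show ?thesis
        using databases_sorted_nth[OF D i, of p "N - 1"] databases_length_list[OF D i] by simp
    qed
    then show ?thesis
      using N_pos unfolding threshold_rounds[OF N_pos order_refl] overall_grade_eq[OF length_D]
      by (intro monotone_aggregationD[OF mono] sorted_grade_in_unit_interval
          grade_in_unit_interval[OF D R]) auto
  qed
  then have "{R \<in> seen (rounds D N). threshold m t (rounds D N) \<le> grade R} = objects D"
    using seen by auto
  then show ?thesis
    using databasesD(2)[OF D] by (simp add: ta_stops_rounds)
qed

definition last_round :: nat where
  "last_round = (LEAST r. ta_stops k m t (rounds D r))"

lemma ta_stops_last_round: "ta_stops k m t (rounds D last_round)"
  unfolding last_round_def using ta_stops_at_N by (rule LeastI)

lemma last_round_le: "ta_stops k m t (rounds D r) \<Longrightarrow> last_round \<le> r"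
  unfolding last_round_def by (rule Least_le)

lemma last_round_le_N: "last_round \<le> N"
  by (rule last_round_le[OF ta_stops_at_N])

lemma last_round_pos: "last_round \<ge> 1"
proof -
  have "\<not> ta_stops k m t (rounds D 0)"
    using k by (simp add: ta_stops_def rounds_0 seen_eq)
  then show ?thesis
    using ta_stops_last_round by (metis One_nat_def Suc_leI gr0I)
qed

text \<open>Minimality of \<open>last_round\<close> makes the stopping test fail before each earlier
  round, and \<open>last_round \<le> N\<close> keeps every sorted access inside its list.\<close>

lemma reachable_rounds: "r \<le> last_round \<Longrightarrow> reachable (TA k m t tie) D (rounds D r)"
proof (induction r)
  case 0
  then show ?case
    by (simp add: rounds_0 reachable.start)
next
  case (Suc r)
  have "reachable (TA k m t tie) D (rounds D r @ blocks D r c)" if "c \<le> m" for c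
    using that
  proof (induction c)
    case 0
    then show ?case
      using Suc by (simp add: blocks_0)
  next
    case (Suc c)
    let ?h = "rounds D r @ blocks D r c"
    have r: "r < N"
      using \<open>Suc r \<le> last_round\<close> last_round_le_N by simp
    have "\<not> (c = 0 \<and> ta_stops k m t ?h)"
      using blocks_0[of D r] \<open>Suc r \<le> last_round\<close> last_round_le[of r] by auto
    moreover have "length ?h = (r * m + c) * m"
      using Suc.prems by (simp add: length_rounds length_blocks length_D algebra_simps)
    moreover have "sorted_result D ?h c = Some (D ! c ! r)"
      using Suc.prems r databases_length_list[OF D, of c]
      by (simp add: sorted_result_def entries_seen_append entries_seen_rounds
          entries_seen_blocks length_D)
    moreover have "reachable (TA k m t tie) D ?h"
      using Suc by simp
    ultimately show ?case
      using TA_block[of c m D ?h "r * m + c" k t tie "D ! c ! r"] Suc.prems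
      by (simp add: blocks_Suc length_D)
  qed
  then show ?case
    by (simp add: rounds_Suc length_D)
qed

lemma halts_last_round:
  "halts_with (TA k m t tie) D (rounds D last_round)
     ((\<lambda>R. (R, seen_grade m t (rounds D last_round) R)) ` tie (rounds D last_round))"
proof -
  have "length (rounds D last_round) mod m = 0"
      and "length (rounds D last_round) div m mod m = 0"
    using m by (simp_all add: length_rounds length_D)
  then show ?thesis
    using reachable_rounds[OF order_refl] ta_stops_last_round
    by (simp add: halts_with_def TA_def ta_action_def)
qed

text \<open>Two halting histories of a deterministic algorithm are prefixes of each other.\<close>

lemma halts_TA_unique:
  assumes "halts_with (TA k m t tie) D h Y"
  shows "h = rounds D last_round"
    and "Y = (\<lambda>R. (R, seen_grade m t (rounds D last_round) R)) ` tie (rounds D last_round)"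
proof -
  have "\<exists>g. h = rounds D last_round @ g"
    by (rule deterministic_halt_extends[OF deterministic_TA reachable_rounds[OF order_refl]
          assms])
  moreover have "\<exists>g. rounds D last_round = h @ g"
    using assms deterministic_halt_extends[OF deterministic_TA _ halts_last_round[of tie]]
    by (auto simp: halts_with_def)
  ultimately show h: "h = rounds D last_round"
    by auto
  have "Halt Y = Halt ((\<lambda>R. (R, seen_grade m t (rounds D last_round) R)) `
      tie (rounds D last_round))"
    using assms halts_last_round[of tie] by (simp only: h halts_with_def TA_def singleton_iff)
  then show "Y = (\<lambda>R. (R, seen_grade m t (rounds D last_round) R)) ` tie (rounds D last_round)"
    by simp
qed

text \<open>The threshold separates the kept objects from the unseen ones; the seen objects that are
  not kept are handled by the choice of \<open>tie\<close>.\<close>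

lemma top_answers_last_round:
  assumes "tie_breaking k m t tie"
  shows "top_answers k t D
    ((\<lambda>R. (R, seen_grade m t (rounds D last_round) R)) ` tie (rounds D last_round))"
proof -
  let ?h = "rounds D last_round" and ?\<tau> = "threshold m t (rounds D last_round)"
  let ?B = "{R \<in> seen ?h. ?\<tau> \<le> grade R}" and ?S = "tie ?h"
  have big: "k \<le> card ?B"
    using ta_stops_last_round ta_stops_rounds[OF last_round_le_N] by simp
  also have "\<dots> \<le> card (seen ?h)"
    by (rule card_mono[OF finite_seen]) auto
  finally have top: "is_top k (seen_grade m t ?h) (seen ?h) ?S"
    using assms unfolding tie_breaking_def by blast
  then have S: "?S \<subseteq> seen ?h" "card ?S = k"
    by (simp_all add: is_top_def)
  have sg: "seen_grade m t ?h R = grade R" if "R \<in> seen ?h" for R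
    by (rule seen_grade_rounds[OF that last_round_le_N])
  have le: "grade R' \<le> grade R" if "R \<in> ?S" "R' \<in> seen ?h - ?S" for R R'
  proof -
    have "seen_grade m t ?h R' \<le> seen_grade m t ?h R"
      using top that unfolding is_top_def by blast
    moreover have "R \<in> seen ?h"
      using that(1) S(1) by blast
    ultimately show ?thesis
      using that(2) by (simp add: sg)
  qed
  \<comment> \<open>If \<open>R\<close> were below the threshold, the at least \<open>k\<close>
    objects that reach it could not all fit into the \<open>k - 1\<close> other places of
    \<open>?S\<close>, so a better seen object would have been dropped.\<close>
  have \<tau>: "?\<tau> \<le> grade R" if R: "R \<in> ?S" for R
  proof (rule ccontr)
    assume small: "\<not> ?\<tau> \<le> grade R"
    have "\<not> ?B \<subseteq> ?S - {R}"
    proof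
      assume "?B \<subseteq> ?S - {R}"
      moreover have "finite (?S - {R})"
        using S(1) finite_seen finite_subset by blast
      ultimately have "card ?B \<le> card (?S - {R})"
        by (rule card_mono[rotated])
      then show False
        using big S(2) R k by simp
    qed
    then obtain R' where "R' \<in> ?B" "R' \<in> seen ?h - ?S"
      using small by blast
    then show False
      using le[OF R, of R'] small by simp
  qed
  \<comment> \<open>In every list an unseen object comes after the last entry read; monotonicity
    carries this over to the overall grade.\<close>
  have unseen: "grade R \<le> ?\<tau>" if R: "R \<in> objects D - seen ?h" for R
  proof -
    have "the (map_of (D ! i) R) \<le> snd (D ! i ! (last_round - 1))" if i: "i < m" for i
    proof -
      obtain x where x: "(R, x) \<in> set (D ! i)"
        using databases_objects_iff[OF D i] R by blast
      have "R \<notin> fst ` set (take last_round (D ! i))"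
        using R i seen_rounds[OF last_round_le_N] by auto
      then have "x \<le> snd (D ! i ! (last_round - 1))"
        using databases_unread_le[OF D i x] last_round_pos by simp
      then show ?thesis
        using x databases_map_of[OF D i, of R x] by simp
    qed
    then show ?thesis
      using R last_round_pos last_round_le_N
      unfolding threshold_rounds[OF last_round_pos last_round_le_N] overall_grade_eq[OF length_D]
      by (intro monotone_aggregationD[OF mono] sorted_grade_in_unit_interval
          grade_in_unit_interval[OF D]) auto
  qed
  have "seen ?h \<subseteq> objects D"
    by (rule history_of_objects[OF D reachable_imp_history_of[OF reachable_rounds[OF order_refl]]])
  moreover have "grade R' \<le> grade R" if "R \<in> ?S" "R' \<in> objects D - ?S" for R R'
  proof (cases "R' \<in> seen ?h")
    case True
    then show ?thesis
      using le[of R R'] that by simp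
  next
    case False
    then show ?thesis
      using order_trans[OF unseen[of R'] \<tau>[of R]] that by simp
  qed
  ultimately have "is_top k grade (objects D) ?S"
    using S unfolding is_top_def by blast
  moreover have "(\<lambda>R. (R, seen_grade m t ?h R)) ` ?S = (\<lambda>R. (R, grade R)) ` ?S"
    using sg S(1) by (intro image_cong) auto
  ultimately show ?thesis
    unfolding top_answers_def by blast
qed

end

lemma TA_in_algorithms:
  fixes tie :: "'a event list \<Rightarrow> 'a set"
  assumes "k \<ge> 1" and "m \<ge> 1" and "monotone_aggregation m t" and "tie_breaking k m t tie"
  shows "TA k m t tie \<in> algorithms k m t"
proof -
  have "(\<exists>h Y. halts_with (TA k m t tie) D h Y) \<and>
      (\<forall>h Y. halts_with (TA k m t tie) D h Y \<longrightarrow> top_answers k t D Y)"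
    if "D \<in> databases k m" for D :: "'a database"
  proof -
    interpret ranked_database k m t D
      using that assms by unfold_locales
    show ?thesis
      using halts_last_round halts_TA_unique(2) top_answers_last_round[OF assms(4)] by metis
  qed
  then show ?thesis
    using no_wild_guesses_TA[OF assms(2)] by (simp add: algorithms_def correct_def)
qed

section \<open>Upper bound\<close>

definition insert_at :: "'a \<Rightarrow> real \<Rightarrow> nat \<Rightarrow> ('a \<times> real) list \<Rightarrow> ('a \<times> real) list" where
  "insert_at V x n L = take n L @ (V, x) # filter (\<lambda>e. fst e \<noteq> V) (drop n L)"

text \<open>\<open>V\<close> is moved to position \<open>n\<close> with the new grade
  \<open>x\<close>. As \<open>V\<close> does not occur in the prefix, deleting it from the rest
  removes its only old entry.\<close>

lemma insert_at:
  assumes "distinct (map fst L)" and "V \<in> fst ` set L" and "V \<notin> fst ` set (take n L)"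
  shows set_insert_at: "set (insert_at V x n L) = insert (V, x) {e \<in> set L. fst e \<noteq> V}"
    and fst_insert_at: "fst ` set (insert_at V x n L) = fst ` set L"
    and distinct_insert_at: "distinct (map fst (insert_at V x n L))"
proof -
  have L: "set L = set (take n L) \<union> set (drop n L)"
    by (metis append_take_drop_id set_append)
  then show 1: "set (insert_at V x n L) = insert (V, x) {e \<in> set L. fst e \<noteq> V}"
    using assms(3) by (force simp: insert_at_def)
  show "fst ` set (insert_at V x n L) = fst ` set L"
    unfolding 1 using assms(2) by force
  have "distinct (map fst (take n L @ drop n L))"
    using assms(1) by simp
  then show "distinct (map fst (insert_at V x n L))"
    unfolding map_append distinct_append using assms(3)
    by (auto simp: insert_at_def distinct_map inj_on_def)
qed

lemma sorted_insert_at: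
  assumes "sorted_wrt (\<ge>) (map snd L)" and "\<And>e. e \<in> set (take n L) \<Longrightarrow> x \<le> snd e"
    and "\<And>e. e \<in> set (drop n L) \<Longrightarrow> snd e \<le> x"
  shows "sorted_wrt (\<ge>) (map snd (insert_at V x n L))"
proof -
  have "sorted_wrt (\<ge>) (map snd (take n L @ drop n L))"
    using assms(1) by simp
  then show ?thesis
    unfolding map_append sorted_wrt_append
    using assms(2,3)
    by (auto simp: insert_at_def sorted_wrt_append sorted_wrt_map intro: sorted_wrt_filter)
      fastforce
qed

lemma map_of_map_inj:
  "inj \<sigma> \<Longrightarrow> map_of (map (map_prod \<sigma> id) L) (\<sigma> R) = map_of L R"
  by (induction L) (auto simp: inj_eq)

text \<open>Applied to the transposition of two unseen objects, which leaves the read prefixes and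
  the grades of seen objects unchanged.\<close>

definition rename_objects :: "('a \<Rightarrow> 'a) \<Rightarrow> 'a database \<Rightarrow> 'a database" where
  "rename_objects \<sigma> D = map (map (map_prod \<sigma> id)) D"

lemma rename_objects:
  assumes "D \<in> databases k m" and "m \<ge> 1" and "inj \<sigma>"
  shows rename_objects_databases: "rename_objects \<sigma> D \<in> databases k m"
    and overall_grade_rename_objects:
      "overall_grade t (rename_objects \<sigma> D) (\<sigma> R) = overall_grade t D R"
proof -
  note len = databasesD(1)[OF assms(1)]
  have nth: "rename_objects \<sigma> D ! i = map (map_prod \<sigma> id) (D ! i)" if "i < m" for i
    using that by (simp add: rename_objects_def len)
  have inj: "inj_on \<sigma> X" for X
    using assms(3) by (rule inj_on_subset) simp
  show "rename_objects \<sigma> D \<in> databases k m"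
  proof (rule databasesI(1)[where X = "\<sigma> ` objects D"])
    show "length (rename_objects \<sigma> D) = m"
      by (simp add: rename_objects_def len)
    show "k \<le> card (\<sigma> ` objects D)"
      using databasesD(2)[OF assms(1)] by (simp add: card_image inj)
    fix i assume i: "i < m"
    have "map fst (rename_objects \<sigma> D ! i) = map \<sigma> (map fst (D ! i))"
      using i by (simp add: nth)
    then show "distinct (map fst (rename_objects \<sigma> D ! i))"
      using databasesD(3)[OF assms(1) i] by (simp add: distinct_map inj del: map_map)
    have "fst ` set (rename_objects \<sigma> D ! i) = \<sigma> ` fst ` set (D ! i)"
      using i by (simp add: nth image_image)
    then show "fst ` set (rename_objects \<sigma> D ! i) = \<sigma> ` objects D"
      using databasesD(4)[OF assms(1) i] by simp
    have snd: "map snd (rename_objects \<sigma> D ! i) = map snd (D ! i)"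
      using i by (simp add: nth)
    then show "sorted_wrt (\<ge>) (map snd (rename_objects \<sigma> D ! i))"
      using databasesD(6)[OF assms(1) i] by simp
    show "snd ` set (rename_objects \<sigma> D ! i) \<subseteq> {0..1}"
      using databasesD(5)[OF assms(1) i] snd by (metis set_map)
  qed (rule assms(2))
  show "overall_grade t (rename_objects \<sigma> D) (\<sigma> R) = overall_grade t D R"
    by (simp add: overall_grade_def rename_objects_def comp_def map_of_map_inj assms(3))
qed

context ranked_database
begin

lemma card_seen_rounds_ge:
  assumes "r \<le> N"
  shows "r \<le> card (seen (rounds D r))"
proof -
  have "distinct (map fst (take r (D ! 0)))"
    using databasesD(3)[OF D, of 0] m by (simp add: take_map[symmetric])
  then have "card (fst ` set (take r (D ! 0))) = r"
    using distinct_card[of "map fst (take r (D ! 0))"] assms databases_length_list[OF D, of 0] m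
    by simp
  moreover have "fst ` set (take r (D ! 0)) \<subseteq> seen (rounds D r)"
    unfolding seen_rounds[OF assms] using m by (intro UN_upper) simp
  ultimately show ?thesis
    using card_mono[OF finite_seen] by metis
qed

text \<open>The core of the upper bound: whatever \<open>A\<close> saw before halting allows TA to
  halt at most \<open>k\<close> rounds deeper.\<close>

lemma last_round_le_card_seen:
  assumes A: "correct k m t A" "no_wild_guesses k m A" and halt: "halts_with A D h Y"
  shows "last_round \<le> card (seen h) + k"
proof (cases "card (seen h) + k < N")
  case False
  then show ?thesis
    using last_round_le_N by simp
next
  case True
  \<comment> \<open>The first summand takes TA at least as deep as \<open>h\<close> in every list;
    the second forces it to see at least \<open>k\<close> objects that \<open>h\<close> did not
    see.\<close>
  define r where "r = card (seen h) + k"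
  have r: "1 \<le> r" "r < N"
    using True k by (simp_all add: r_def)
  have reach: "reachable A D h"
    using halt by (simp add: halts_with_def)
  then have hist: "history_of D h"
    by (rule reachable_imp_history_of)
  define n where "n i = length (entries_seen i h)" for i
  have entries: "entries_seen i h = take (n i) (D ! i)" if "i < m" for i
    using history_of_entries_seen[OF hist, of i] that by (simp add: n_def length_D)
  have n_len: "n i \<le> length (D ! i)" if "i < m" for i
    using history_of_length_entries_seen[OF hist, of i] that by (simp add: n_def length_D)
  have take_seen: "fst ` set (take (n i) (D ! i)) \<subseteq> seen h" if "i < m" for i
    unfolding seen_def entries[OF that, symmetric] by blast
  have n_le: "n i \<le> card (seen h)" for i
    unfolding n_def by (rule length_entries_seen_le_card_seen[OF D hist])
  have seen_rounds_r: "seen h \<subseteq> seen (rounds D r)"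
  proof
    fix R assume "R \<in> seen h"
    then obtain i where i: "R \<in> fst ` set (entries_seen i h)"
      by (auto simp: seen_def)
    then have "i < m"
      using history_of_entries_seen[OF hist, of i] by (auto simp: length_D split: if_splits)
    moreover have "set (take (n i) (D ! i)) \<subseteq> set (take r (D ! i))"
      using n_le[of i] by (intro set_take_subset_set_take) (simp add: r_def)
    ultimately show "R \<in> seen (rounds D r)"
      using i r(2) entries[OF \<open>i < m\<close>] by (auto simp: seen_rounds)
  qed
  have Random_seen: "R \<in> seen h" if "Random_Event R i v \<in> set h" for R i v
    by (rule no_wild_guesses_Random_seen[OF A(2) D reach that])
  \<comment> \<open>Such a \<open>D'\<close> cannot be told from \<open>D\<close> by
    \<open>h\<close>, so \<open>A\<close> halts on it with the same \<open>Y\<close>, which must be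
    right there too.\<close>
  have same_answer: "top_answers k t D' Y"
    if D': "D' \<in> databases k m" and lists: "\<And>i. i < m \<Longrightarrow> length (D' ! i) = length (D ! i)"
        "\<And>i. i < m \<Longrightarrow> take (n i) (D' ! i) = take (n i) (D ! i)"
      and seen_same: "\<And>R i. R \<in> seen h \<Longrightarrow> i < m \<Longrightarrow> map_of (D' ! i) R = map_of (D ! i) R"
    for D'
  proof -
    have "history_of D' h"
    proof (rule history_of_cong[OF hist])
      show "length D' = length D"
        using databasesD(1)[OF D'] length_D by simp
      show "random_result D' R i = random_result D R i" if "Random_Event R i v \<in> set h" for R i v
        using seen_same[OF Random_seen[OF that], of i] databasesD(1)[OF D'] length_D
        by (simp add: random_result_def)
    qed (simp_all add: lists length_D flip: n_def)
    then have "halts_with A D' h Y"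
      using halt reachable_transfer by (auto simp: halts_with_def)
    then show ?thesis
      using A(1) D' by (auto simp: correct_def)
  qed
  obtain S where S: "is_top k grade (objects D) S" and Y: "Y = (\<lambda>R. (R, grade R)) ` S"
    using A(1) D halt unfolding correct_def top_answers_def by blast
  \<comment> \<open>Answers carry their grades, so the members of \<open>S\<close> keep their
    overall grades in every \<open>D'\<close> with the same answer.\<close>
  have grade_same: "overall_grade t D' R = grade R"
    if "top_answers k t D' Y" and "R \<in> S" for D' R
    using that unfolding top_answers_def Y by blast
  have top_same: "is_top k (overall_grade t D') (objects D') S"
    if ans: "top_answers k t D' Y" for D'
  proof -
    obtain S' where S': "is_top k (overall_grade t D') (objects D') S'"
        "Y = (\<lambda>R. (R, overall_grade t D' R)) ` S'"
      using ans unfolding top_answers_def by blast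
    have "S' = fst ` Y"
      unfolding S'(2) by (simp add: image_image)
    also have "\<dots> = S"
      unfolding Y by (simp add: image_image)
    finally show ?thesis
      using S'(1) by simp
  qed
  have card_S: "card S = k" and S_sub: "S \<subseteq> objects D"
    using S by (simp_all add: is_top_def)
  have seen_sub: "seen h \<subseteq> objects D"
    by (rule history_of_objects[OF D hist])
  let ?\<tau> = "threshold m t (rounds D r)"
  have S_big: "?\<tau> \<le> grade R" if R: "R \<in> S" for R
  proof -
    have "finite S"
      using S_sub finite_objects finite_subset by blast
    have "card (seen h \<union> S) < N"
      using card_Un_le[of "seen h" S] card_S True by simp
    then have "\<not> objects D \<subseteq> seen h \<union> S"
      using card_mono[of "seen h \<union> S" "objects D"] finite_seen[of h] \<open>finite S\<close> by auto
    then obtain V where V: "V \<in> objects D" "V \<notin> seen h" "V \<notin> S"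
      by blast
    \<comment> \<open>The largest grade that \<open>V\<close> can take right after the prefix read
      by \<open>h\<close>: the last grade read, or 1 in a list not yet touched.\<close>
    define x where "x i = (if n i = 0 then 1 else snd (D ! i ! (n i - 1)))" for i
    define D' where "D' = map (\<lambda>i. insert_at V (x i) (n i) (D ! i)) [0..<m]"
    have D'_nth: "D' ! i = insert_at V (x i) (n i) (D ! i)" if "i < m" for i
      using that by (simp add: D'_def)
    have n_less: "n i < N" if "i < m" for i
      using n_le[of i] True by simp
    have x_unit: "x i \<in> {0..1}" if i: "i < m" for i
      using sorted_grade_in_unit_interval[OF i, of "n i - 1"] n_less[OF i]
      by (auto simp: x_def)
    have V_list: "V \<in> fst ` set (D ! i)" "V \<notin> fst ` set (take (n i) (D ! i))" if "i < m" for i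
      using V(1,2) databasesD(4)[OF D that] take_seen[OF that] by auto
    note ins = insert_at[OF databasesD(3)[OF D] V_list]
    have sorted: "sorted_wrt (\<ge>) (map snd (D' ! i))" if i: "i < m" for i
      unfolding D'_nth[OF i]
    proof (rule sorted_insert_at[OF databasesD(6)[OF D i]])
      fix e assume "e \<in> set (take (n i) (D ! i))"
      then obtain p where "p < n i" "e = D ! i ! p"
        using n_len[OF i] by (auto simp: in_set_conv_nth)
      then show "x i \<le> snd e"
        using databases_sorted_nth[OF D i, of p "n i - 1"] n_len[OF i] by (simp add: x_def)
    next
      fix e assume e: "e \<in> set (drop (n i) (D ! i))"
      then obtain p where "p < length (drop (n i) (D ! i))" "drop (n i) (D ! i) ! p = e"
        by (metis in_set_conv_nth)
      then have p: "n i + p < length (D ! i)" "e = D ! i ! (n i + p)"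
        by simp_all
      show "snd e \<le> x i"
      proof (cases "n i = 0")
        case True
        then show ?thesis
          using sorted_grade_in_unit_interval[OF i, of p] p databases_length_list[OF D i]
          by (simp add: x_def)
      next
        case False
        then show ?thesis
          using databases_sorted_nth[OF D i, of "n i - 1" "n i + p"] p by (simp add: x_def)
      qed
    qed
    have unit: "snd ` set (D' ! i) \<subseteq> {0..1}" if i: "i < m" for i
      using x_unit[OF i] databasesD(5)[OF D i] unfolding D'_nth[OF i] ins(1)[OF i i i] by auto
    note D'I = databasesI[of D' m k "objects D"]
    have D': "D' \<in> databases k m" and obj: "objects D' = objects D"
      using D'I m databasesD(2,4)[OF D] sorted unit ins(2,3) D'_nth
      by (simp_all add: D'_def)
    have map_of_other: "map_of (D' ! i) R = map_of (D ! i) R" if "R \<noteq> V" "i < m" for R i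
    proof (rule option.expand)
      have "map_of (D' ! i) R = Some y \<longleftrightarrow> map_of (D ! i) R = Some y" for y
        using that databases_map_of[OF D that(2)] databases_map_of[OF D' that(2)]
        by (simp add: D'_nth ins(1))
      then show "(map_of (D' ! i) R = None) = (map_of (D ! i) R = None)"
          "\<lbrakk>map_of (D' ! i) R \<noteq> None; map_of (D ! i) R \<noteq> None\<rbrakk> \<Longrightarrow>
            the (map_of (D' ! i) R) = the (map_of (D ! i) R)"
        by (metis not_None_eq, metis option.exhaust_sel option.sel)
    qed
    have ans: "top_answers k t D' Y"
    proof (rule same_answer[OF D'])
      show "length (D' ! i) = length (D ! i)" if "i < m" for i
        using databases_length_list[OF D' that] databases_length_list[OF D that] obj by simp
      show "take (n i) (D' ! i) = take (n i) (D ! i)" if "i < m" for i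
        using n_len[OF that] by (simp add: D'_nth that insert_at_def)
      show "map_of (D' ! i) R = map_of (D ! i) R" if "R \<in> seen h" "i < m" for R i
        using that V(2) by (intro map_of_other) auto
    qed
    have "map_of (D' ! i) V = Some (x i)" if i: "i < m" for i
      using databases_map_of[OF D' i, of V "x i"] ins(1)[OF i i i] by (simp add: D'_nth i)
    then have "map (\<lambda>i. the (map_of (D' ! i) V)) [0..<m] = map x [0..<m]"
      by simp
    then have "overall_grade t D' V = t (map x [0..<m])"
      using overall_grade_eq[OF databasesD(1)[OF D'], of t V] by (simp only:)
    \<comment> \<open>\<open>V\<close> is outside \<open>S\<close>, and \<open>S\<close> is also a
      top set of \<open>D'\<close>.\<close>
    moreover have "overall_grade t D' V \<le> grade R"
      using top_same[OF ans] grade_same[OF ans R] V R obj unfolding is_top_def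
      by (metis DiffI)
    \<comment> \<open>TA's last entries lie at least as deep as those of \<open>h\<close>, so they
      are bounded by \<open>x\<close>.\<close>
    moreover have "?\<tau> \<le> t (map x [0..<m])"
    proof -
      have "snd (D ! i ! (r - 1)) \<le> x i" if i: "i < m" for i
      proof (cases "n i = 0")
        case True
        then show ?thesis
          using sorted_grade_in_unit_interval[OF i, of "r - 1"] r by (simp add: x_def)
      next
        case False
        then show ?thesis
          using databases_sorted_nth[OF D i, of "n i - 1" "r - 1"] n_le[of i] r
            databases_length_list[OF D i] by (simp add: x_def r_def)
      qed
      then show ?thesis
        using r x_unit unfolding threshold_rounds[OF r(1) less_imp_le[OF r(2)]]
        by (intro monotone_aggregationD[OF mono] sorted_grade_in_unit_interval) auto
    qed
    ultimately show ?thesis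
      by simp
  qed
  let ?B = "{R \<in> seen (rounds D r). ?\<tau> \<le> grade R}"
  have fin: "finite ?B"
    using finite_seen[of "rounds D r"] by simp
  have "k \<le> card ?B"
  proof (cases "S \<subseteq> seen h")
    case True
    then have "S \<subseteq> ?B"
      using S_big seen_rounds_r by blast
    then show ?thesis
      using card_mono[OF fin] card_S by blast
  next
    case False
    then obtain R where R: "R \<in> S" "R \<notin> seen h"
      by blast
    \<comment> \<open>After \<open>R\<close> and \<open>U\<close> are swapped, \<open>R\<close> has
      the old grades of \<open>U\<close>. The unchanged answer still reports the old grade of
      \<open>R\<close>, so the two overall grades coincide.\<close>
    have same: "grade U = grade R" if U: "U \<in> seen (rounds D r) - seen h" for U
    proof -
      define \<sigma> where "\<sigma> = id(R := U, U := R)"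
      have \<sigma>: "\<sigma> (\<sigma> x) = x" for x
        by (auto simp: \<sigma>_def)
      then have "inj \<sigma>"
        by (metis injI)
      note ren = rename_objects[OF D m \<open>inj \<sigma>\<close>]
      have fixed: "\<sigma> x = x" if "x \<in> seen h" for x
        using that R(2) U by (auto simp: \<sigma>_def)
      have nth: "rename_objects \<sigma> D ! i = map (map_prod \<sigma> id) (D ! i)" if "i < m" for i
        using that by (simp add: rename_objects_def length_D)
      have "top_answers k t (rename_objects \<sigma> D) Y"
      proof (rule same_answer[OF ren(1)])
        show "length (rename_objects \<sigma> D ! i) = length (D ! i)" if "i < m" for i
          using that by (simp add: nth)
        show "take (n i) (rename_objects \<sigma> D ! i) = take (n i) (D ! i)" if i: "i < m" for i
          unfolding nth[OF i] take_map using take_seen[OF i] fixed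
          by (intro map_idI) (force simp: map_prod_def split: prod.splits)
        show "map_of (rename_objects \<sigma> D ! i) x = map_of (D ! i) x"
          if "x \<in> seen h" "i < m" for x i
          using map_of_map_inj[OF \<open>inj \<sigma>\<close>, of "D ! i" x] fixed[OF that(1)] nth[OF that(2)] by simp
      qed
      then have "overall_grade t (rename_objects \<sigma> D) R = grade R"
        using grade_same R(1) by blast
      moreover have "overall_grade t (rename_objects \<sigma> D) (\<sigma> U) = grade U"
        by (rule ren(2))
      moreover have "\<sigma> U = R"
        by (simp add: \<sigma>_def)
      ultimately show ?thesis
        by simp
    qed
    then have "seen (rounds D r) - seen h \<subseteq> ?B"
      using S_big[OF R(1)] by auto
    then have "card (seen (rounds D r) - seen h) \<le> card ?B"
      by (rule card_mono[OF fin])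
    moreover have "card (seen (rounds D r) - seen h) = card (seen (rounds D r)) - card (seen h)"
      by (rule card_Diff_subset[OF finite_seen seen_rounds_r])
    moreover have "r \<le> card (seen (rounds D r))"
      using card_seen_rounds_ge r by simp
    ultimately show ?thesis
      by (simp add: r_def)
  qed
  then have "ta_stops k m t (rounds D r)"
    using r by (simp add: ta_stops_rounds)
  then show ?thesis
    using last_round_le by (simp add: r_def)
qed

end

text \<open>\<open>c\<close> is the cost of one round of TA, and \<open>A\<close> pays at least
  \<open>cS\<close> per seen object. The \<open>k\<close> additional rounds form the additive
  constant \<open>k * c\<close>, which does not depend on the database.\<close>

theorem TA_instance_optimal:
  fixes tie :: "'a event list \<Rightarrow> 'a set"
  assumes "k \<ge> 1" and "m \<ge> 1" and "cS > 0" and "cR > 0"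
    and "monotone_aggregation m t" and "tie_breaking k m t tie"
  shows "instance_optimal (middleware_cost cS cR) (algorithms k m t) (databases k m)
    (TA k m t tie) (ta_ratio m cS cR)"
proof -
  define c where "c = real m * (cS + real (m - 1) * cR)"
  have c: "c = ta_ratio m cS cR * cS"
    using assms(2,3) by (simp add: c_def ta_ratio_def field_simps of_nat_diff)
  have "c > 0"
    using assms(2-4) by (auto simp: c_def intro!: mult_pos_pos add_pos_nonneg)
  then have ratio: "ta_ratio m cS cR > 0"
    using c assms(3) by (simp add: zero_less_mult_iff)
  have "middleware_cost cS cR (TA k m t tie) D \<le>
      ta_ratio m cS cR * middleware_cost cS cR A D + real k * c"
    if A: "A \<in> algorithms k m t" and D: "D \<in> databases k m"
    for A :: "'a algorithm" and D :: "'a database"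
  proof -
    interpret ranked_database k m t D
      using D assms by unfold_locales
    have corr: "correct k m t A" "no_wild_guesses k m A"
      using A by (simp_all add: algorithms_def)
    \<comment> \<open>Solved for the cost of \<open>A\<close>, an infimum, so that it suffices to
      bound each halting history of \<open>A\<close> from below.\<close>
    have "(middleware_cost cS cR (TA k m t tie) D - real k * c) / ta_ratio m cS cR \<le>
        middleware_cost cS cR A D"
    proof (rule middleware_cost_ge[OF corr(1) D])
      fix h Y assume halt: "halts_with A D h Y"
      have "middleware_cost cS cR (TA k m t tie) D \<le> history_cost cS cR (rounds D last_round)"
        using assms by (intro middleware_cost_le[OF _ _ halts_last_round]) auto
      also have "\<dots> = real last_round * c"
        by (simp add: history_cost_rounds length_D c_def)
      also have "\<dots> \<le> real (card (seen h) + k) * c"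
        using last_round_le_card_seen[OF corr halt] \<open>c > 0\<close> by (intro mult_right_mono) auto
      also have "\<dots> = ta_ratio m cS cR * (cS * real (card (seen h))) + real k * c"
        by (simp add: c algebra_simps)
      also have "cS * real (card (seen h)) \<le> history_cost cS cR h"
      proof -
        have "0 \<le> cR * real (card (probes h))"
          using assms(4) by simp
        then show ?thesis
          using history_cost_ge[of cS cR h] assms(3,4) by linarith
      qed
      finally show "(middleware_cost cS cR (TA k m t tie) D - real k * c) / ta_ratio m cS cR \<le>
          history_cost cS cR h"
        using ratio by (simp add: field_simps)
    qed
    then show ?thesis
      using ratio by (simp add: field_simps)
  qed
  then show ?thesis
    unfolding instance_optimal_def using TA_in_algorithms[OF assms(1,2,5,6)] by blast
qed

section \<open>A family of hard databases\<close>

text \<open>The competitor of the lower bound: a nondeterministic algorithm whose cheapest branch is a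
  shortest certificate for the top \<open>k\<close> answers.\<close>

definition verifier :: "nat \<Rightarrow> nat \<Rightarrow> (real list \<Rightarrow> real) \<Rightarrow> 'a algorithm" where
  "verifier k m t h = range Do_Sorted \<union> {Do_Random R i | R i. R \<in> seen h} \<union>
     {Halt Y | Y. \<forall>D\<in>databases k m. history_of D h \<longrightarrow> top_answers k t D Y}"

lemma verifier_actions:
  "Do_Sorted i \<in> verifier k m t h"
  "Do_Random R i \<in> verifier k m t h \<longleftrightarrow> R \<in> seen h"
  "Halt Y \<in> verifier k m t h \<longleftrightarrow>
     (\<forall>D\<in>databases k m. history_of D h \<longrightarrow> top_answers k t D Y)"
  by (auto simp: verifier_def)

text \<open>Wrong answers are excluded by the condition on \<open>Halt\<close>. A halting branch
  exists because the final history of TA is a certificate: on every database that fits it, TA gives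
  the same, correct answer.\<close>

lemma verifier_in_algorithms:
  fixes tie :: "'a event list \<Rightarrow> 'a set"
  assumes "k \<ge> 1" and "m \<ge> 1" and "monotone_aggregation m t" and "tie_breaking k m t tie"
  shows "(verifier k m t :: 'a algorithm) \<in> algorithms k m t"
proof -
  let ?TA = "TA k m t tie"
  have TA: "correct k m t ?TA" "no_wild_guesses k m ?TA"
    using TA_in_algorithms[OF assms] by (simp_all add: algorithms_def)
  have "\<exists>h Y. halts_with (verifier k m t) D h Y" if D: "D \<in> databases k m" for D :: "'a database"
  proof -
    obtain h Y where h: "reachable ?TA D h" "Halt Y \<in> ?TA h"
      using TA(1) D by (auto simp: correct_def halts_with_def)
    from h(1) have "reachable (verifier k m t) D h"
    proof (induction rule: reachable.induct)
      case (random_step h R i)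
      then have "R \<in> seen h"
        using TA(2) D by (auto simp: no_wild_guesses_def)
      then show ?case
        using random_step.IH by (auto simp: verifier_actions intro: reachable.random_step)
    qed (auto simp: verifier_actions intro: reachable.start reachable.sorted_step)
    moreover have "top_answers k t D' Y" if "D' \<in> databases k m" "history_of D' h" for D'
      using reachable_transfer[OF h(1) that(2)] h(2) TA(1) that(1)
      by (auto simp: correct_def halts_with_def)
    ultimately show ?thesis
      by (auto simp: halts_with_def verifier_actions)
  qed
  moreover have "top_answers k t D Y"
    if "D \<in> databases k m" and "halts_with (verifier k m t) D h Y" for D :: "'a database" and h Y
    using that reachable_imp_history_of by (auto simp: halts_with_def verifier_actions)
  moreover have "no_wild_guesses k m (verifier k m t :: 'a algorithm)"
    by (auto simp: no_wild_guesses_def verifier_actions)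
  ultimately show ?thesis
    by (auto simp: algorithms_def correct_def)
qed

lemma entries_seen_Sorted_Events:
  "entries_seen i (map (\<lambda>e. Sorted_Event j (Some e)) xs) = (if j = i then xs else [])"
  by (induction xs) auto

lemma reachable_verifier_sorted:
  assumes "i < length D" and "p \<le> length (D ! i)"
  shows "reachable (verifier k m t) D (map (\<lambda>e. Sorted_Event i (Some e)) (take p (D ! i)))"
  using assms(2)
proof (induction p)
  case 0
  then show ?case by (simp add: reachable.start)
next
  case (Suc p)
  let ?h = "map (\<lambda>e. Sorted_Event i (Some e)) (take p (D ! i))"
  have "reachable (verifier k m t) D (?h @ [Sorted_Event i (sorted_result D ?h i)])"
    using Suc by (intro reachable.sorted_step) (simp_all add: verifier_actions)
  moreover have "sorted_result D ?h i = Some (D ! i ! p)"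
    using assms(1) Suc.prems by (simp add: sorted_result_def entries_seen_Sorted_Events)
  ultimately show ?case
    using Suc.prems by (simp add: take_Suc_conv_app_nth)
qed

lemma reachable_verifier_random:
  assumes "reachable (verifier k m t) D h" and "\<And>R j. (R, j) \<in> set xs \<Longrightarrow> R \<in> seen h"
  shows "reachable (verifier k m t) D
    (h @ map (\<lambda>(R, j). Random_Event R j (random_result D R j)) xs)"
  using assms(2)
proof (induction xs rule: rev_induct)
  case Nil
  then show ?case using assms(1) by simp
next
  case (snoc x xs)
  obtain R j where x: "x = (R, j)"
    by (cases x)
  let ?h = "h @ map (\<lambda>(R, j). Random_Event R j (random_result D R j)) xs"
  have "reachable (verifier k m t) D (?h @ [Random_Event R j (random_result D R j)])"
    using snoc x by (intro reachable.random_step) (auto simp: verifier_actions seen_append)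
  then show ?case
    by (simp add: x)
qed

text \<open>Strictness gives the all-1 point the value 1, and monotonicity makes this the maximum.
  An object with all grades 1 is thus recognizable as a top answer without knowing the
  others.\<close>

lemma strict_monotone_le_1:
  assumes "monotone_aggregation m t" and "strict_aggregation m t"
    and "\<And>i. i < m \<Longrightarrow> g i \<in> {0..1}"
  shows "t (map g [0..<m]) \<le> 1"
    and "t (map g [0..<m]) = 1 \<longleftrightarrow> (\<forall>i<m. g i = 1)"
proof -
  have *: "t (map g [0..<m]) = 1 \<longleftrightarrow> (\<forall>i<m. g i = 1)"
    if "\<And>i. i < m \<Longrightarrow> g i \<in> {0..1}" for g :: "nat \<Rightarrow> real"
    using assms(2) that unfolding strict_aggregation_def by (simp add: Ball_def map_in_unit_cube)
  then show "t (map g [0..<m]) = 1 \<longleftrightarrow> (\<forall>i<m. g i = 1)"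
    using assms(3) .
  have "t (map g [0..<m]) \<le> t (map (\<lambda>_. 1) [0..<m])"
    using assms(3) by (intro monotone_aggregationD[OF assms(1)]) auto
  also have "\<dots> = 1"
    using *[of "\<lambda>_. 1"] by simp
  finally show "t (map g [0..<m]) \<le> 1" .
qed

text \<open>Here \<open>k\<close> is \<open>Suc w\<close>. The leaders \<open>W\<close> head every
  list, \<open>H i\<close> follows in list \<open>i\<close>, and its first \<open>d\<close> members
  are the candidates of that list. \<open>U\<close> enumerates all objects and fixes the order of
  the remaining entries.\<close>

locale hard_instances =
  fixes w m n d :: nat and t :: "real list \<Rightarrow> real"
    and U W :: "'a list" and H :: "nat \<Rightarrow> 'a list"
  assumes m: "m \<ge> 2" and d: "1 \<le> d" "d \<le> n"
    and mono: "monotone_aggregation m t" and strict: "strict_aggregation m t"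
    and U: "distinct U" "set U = set W \<union> (\<Union>i<m. set (H i))"
    and W: "distinct W" "length W = w"
    and H: "\<And>i. distinct (H i)" "\<And>i. length (H i) = n"
    and W_H: "\<And>i. set W \<inter> set (H i) = {}"
    and H_H: "\<And>i j. i \<noteq> j \<Longrightarrow> set (H i) \<inter> set (H j) = {}"
begin

text \<open>The prefix \<open>W @ H i\<close> is independent of \<open>f\<close>, so sorted access
  to it reveals nothing about \<open>f\<close>. Grades 0 come last to keep the list sorted.\<close>

definition list_order :: "('a \<Rightarrow> nat) \<Rightarrow> nat \<Rightarrow> 'a list" where
  "list_order f i = W @ H i @
     filter (\<lambda>R. R \<notin> set W \<union> set (H i) \<and> f R \<noteq> i) U @
     filter (\<lambda>R. R \<notin> set W \<union> set (H i) \<and> f R = i) U"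

text \<open>\<open>f R\<close> is the only list in which \<open>R\<close> has grade 0; there is none if \<open>m \<le> f R\<close>.\<close>

definition db :: "('a \<Rightarrow> nat) \<Rightarrow> 'a database" where
  "db f = map (\<lambda>i. map (\<lambda>R. (R, if f R = i then 0 else 1)) (list_order f i)) [0..<m]"

text \<open>Keeps the grade 0 out of the prefix \<open>W @ H i\<close> of each list and makes the
  leaders perfect.\<close>

definition valid :: "('a \<Rightarrow> nat) \<Rightarrow> bool" where
  "valid f \<longleftrightarrow> (\<forall>R\<in>set W. m \<le> f R) \<and> (\<forall>i<m. \<forall>R\<in>set (H i). f R \<noteq> i)"

lemma length_db: "length (db f) = m"
  by (simp add: db_def)

lemma db_nth: "i < m \<Longrightarrow> db f ! i = map (\<lambda>R. (R, if f R = i then 0 else 1)) (list_order f i)"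
  by (simp add: db_def)

lemma set_list_order: "i < m \<Longrightarrow> set (list_order f i) = set U"
  unfolding list_order_def set_append set_filter U(2) by blast

lemma distinct_list_order: "distinct (list_order f i)"
  using W(1) H(1)[of i] U(1) W_H[of i] by (auto simp: list_order_def)

lemma length_list_order: "i < m \<Longrightarrow> length (list_order f i) = length U"
  using distinct_card[OF distinct_list_order, of f i] distinct_card[OF U(1)] set_list_order by simp

lemma Suc_w_le_card_U: "Suc w \<le> card (set U)"
proof -
  have "set W \<union> set (H 0) \<subseteq> set U"
    using U(2) m by auto
  then have "card (set W \<union> set (H 0)) \<le> card (set U)"
    by (intro card_mono) auto
  moreover have "card (set W \<union> set (H 0)) = w + n"
    using W_H[of 0] W H[of 0] by (simp add: card_Un_disjoint distinct_card)
  ultimately show ?thesis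
    using d by simp
qed

lemma db_databases:
  assumes "valid f"
  shows "db f \<in> databases (Suc w) m" and "objects (db f) = set U"
proof -
  have *: "length (db f) = m" "m \<ge> 1" "Suc w \<le> card (set U)"
    using m by (simp_all add: length_db Suc_w_le_card_U)
  have distinct: "distinct (map fst (db f ! i))" if "i < m" for i
    using distinct_list_order[of f i] by (simp add: db_nth that comp_def)
  have sets: "fst ` set (db f ! i) = set U" if "i < m" for i
    using set_list_order[OF that] by (simp add: db_nth that image_image)
  have unit: "snd ` set (db f ! i) \<subseteq> {0..1}" if "i < m" for i
    by (auto simp: db_nth that)
  have sorted: "sorted_wrt (\<ge>) (map snd (db f ! i))" if "i < m" for i
  proof -
    define g where "g R = (if f R = i then 0 else 1 :: real)" for R
    let ?ys = "filter (\<lambda>R. R \<notin> set W \<union> set (H i) \<and> f R = i) U"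
    obtain xs where xs: "list_order f i = xs @ ?ys" and
      xs_def: "xs = W @ H i @ filter (\<lambda>R. R \<notin> set W \<union> set (H i) \<and> f R \<noteq> i) U"
      by (simp add: list_order_def)
    have g1: "g R = 1" if "R \<in> set xs" for R
      using that assms \<open>i < m\<close> by (auto simp: g_def xs_def valid_def)
    have "map g xs = map (\<lambda>_. 1) xs"
      by (rule map_cong[OF refl g1])
    then have 1: "map g xs = replicate (length xs) 1"
      by (simp add: map_replicate_const)
    have "map g ?ys = map (\<lambda>_. 0) ?ys"
      by (rule map_cong[OF refl]) (simp add: g_def)
    then have 0: "map g ?ys = replicate (length ?ys) 0"
      by (simp add: map_replicate_const)
    have "map snd (db f ! i) = map g (list_order f i)"
      by (simp add: db_nth that g_def)
    also have "\<dots> = replicate (length xs) 1 @ replicate (length ?ys) 0"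
      unfolding xs map_append 1 0 ..
    moreover have "sorted_wrt (\<ge>) (replicate l x)" for l and x :: real
      by (induction l) auto
    ultimately show ?thesis
      by (auto simp: sorted_wrt_append)
  qed
  note I = databasesI[of "db f" m "Suc w" "set U"]
  show "db f \<in> databases (Suc w) m" and "objects (db f) = set U"
    by (rule I; use * distinct sets unit sorted in blast)+
qed

lemma map_of_db:
  assumes "i < m"
  shows "map_of (db f ! i) R = (if R \<in> set U then Some (if f R = i then 0 else 1) else None)"
  unfolding db_nth[OF assms]
  by (auto simp: map_of_map_restrict restrict_map_def set_list_order[OF assms])

lemma overall_grade_db:
  assumes "R \<in> set U"
  shows "overall_grade t (db f) R = t (map (\<lambda>i. if f R = i then 0 else 1) [0..<m])"
proof -
  have "map (\<lambda>i. the (map_of (db f ! i) R)) [0..<m] = map (\<lambda>i. if f R = i then 0 else 1) [0..<m]"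
    using assms by (simp add: map_of_db)
  then show ?thesis
    unfolding overall_grade_eq[OF length_db] by (rule arg_cong)
qed

lemma overall_grade_db_le_1: "R \<in> set U \<Longrightarrow> overall_grade t (db f) R \<le> 1"
  and overall_grade_db_eq_1: "R \<in> set U \<Longrightarrow> overall_grade t (db f) R = 1 \<longleftrightarrow> m \<le> f R"
proof -
  assume R: "R \<in> set U"
  let ?g = "\<lambda>i. if f R = i then 0 else 1 :: real"
  show "overall_grade t (db f) R \<le> 1"
    unfolding overall_grade_db[OF R] by (intro strict_monotone_le_1[OF mono strict]) auto
  have "t (map ?g [0..<m]) = 1 \<longleftrightarrow> (\<forall>i<m. ?g i = 1)"
    by (intro strict_monotone_le_1[OF mono strict]) auto
  then show "overall_grade t (db f) R = 1 \<longleftrightarrow> m \<le> f R"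
    unfolding overall_grade_db[OF R] by (auto simp: not_le)
qed

lemma take_db:
  assumes "valid f" and "i < m" and "p \<le> w + n"
  shows "take p (db f ! i) = take p (map (\<lambda>R. (R, 1)) (W @ H i))"
proof -
  have "take p (list_order f i) = take p (W @ H i)"
    using assms(3) W H by (simp add: list_order_def)
  then have "take p (db f ! i) = take p (map (\<lambda>R. (R, if f R = i then 0 else 1)) (W @ H i))"
    by (simp only: db_nth[OF assms(2)] take_map)
  also have "map (\<lambda>R. (R, if f R = i then 0 else 1 :: real)) (W @ H i) =
      map (\<lambda>R. (R, 1)) (W @ H i)"
    using assms(1,2) by (auto simp: valid_def)
  finally show ?thesis .
qed

text \<open>Down to depth \<open>w + n\<close> the lists agree for all valid \<open>f\<close>, so
  only the probed fields can tell two such databases apart.\<close>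

lemma history_of_db_cong:
  assumes "history_of (db f) h" and "valid f" and "valid f'"
    and depth: "\<And>i. i < m \<Longrightarrow> length (entries_seen i h) \<le> w + n"
    and same: "\<And>R i. (R, i) \<in> probes h \<Longrightarrow> i < m \<Longrightarrow> f R = i \<longleftrightarrow> f' R = i"
  shows "history_of (db f') h"
proof (rule history_of_cong[OF assms(1)])
  show "random_result (db f') R i = random_result (db f) R i" if "Random_Event R i r \<in> set h"
    for R i r
    using same[of R i] that by (auto simp: random_result_def length_db map_of_db probes_def)
  show "length (db f' ! i) = length (db f ! i)" if "i < length (db f)" for i
    using that by (simp add: length_db db_nth length_list_order)
  show "take (length (entries_seen i h)) (db f' ! i) = take (length (entries_seen i h)) (db f ! i)"
    if "i < length (db f)" for i
    using that depth[of i] assms(2,3) by (simp only: length_db take_db)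
qed (simp add: length_db)

section \<open>Candidates, and the cost of certifying a perfect one\<close>

definition candidates :: "nat \<Rightarrow> 'a set" where
  "candidates i = set (take d (H i))"

definition other_lists :: "nat \<Rightarrow> 'a \<Rightarrow> ('a \<times> nat) set" where
  "other_lists i R = {R} \<times> ({..<m} - {i})"

lemma candidates_sub: "candidates i \<subseteq> set (H i)"
  unfolding candidates_def by (rule set_take_subset)

lemma H_sub_U: "i < m \<Longrightarrow> set (H i) \<subseteq> set U"
  using U(2) by auto

lemma W_sub_U: "set W \<subseteq> set U"
  using U(2) by auto

lemma card_candidates: "card (candidates i) = d"
  using H[of i] d distinct_card[of "take d (H i)"] by (simp add: candidates_def)

lemma candidates_disjoint: "i \<noteq> j \<Longrightarrow> candidates i \<inter> candidates j = {}"
  using candidates_sub H_H by blast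

lemma card_all_candidates: "card (\<Union>i<m. candidates i) = m * d"
proof -
  have "card (\<Union>i<m. candidates i) = (\<Sum>i<m. card (candidates i))"
    using candidates_disjoint by (intro card_UN_disjoint) (auto simp: candidates_def)
  then show ?thesis
    by (simp add: card_candidates)
qed

lemma card_all_other_lists:
  "card (\<Union>i<m. candidates i \<times> ({..<m} - {i})) = m * d * (m - 1)"
proof -
  have "card (\<Union>i<m. candidates i \<times> ({..<m} - {i})) =
      (\<Sum>i<m. card (candidates i \<times> ({..<m} - {i})))"
    using candidates_disjoint by (intro card_UN_disjoint) (auto simp: candidates_def)
  also have "\<dots> = (\<Sum>i<m. d * (m - 1))"
    by (intro sum.cong) (simp_all add: card_cartesian_product card_candidates)
  finally show ?thesis
    by simp
qed

text \<open>\<open>T\<close> is a candidate without a grade 0. The first \<open>w + d\<close>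
  entries of its list contain \<open>T\<close> and all leaders; probing all their fields certifies
  \<open>Suc w\<close> objects of the maximal grade. Only the sorted part grows with
  \<open>d\<close>.\<close>

lemma middleware_cost_verifier_le:
  fixes cS cR :: real
  assumes "cS > 0" and "cR > 0" and f: "valid f" and i: "i < m"
    and T: "T \<in> candidates i" "m \<le> f T"
  shows "middleware_cost cS cR (verifier (Suc w) m t) (db f) \<le>
    real (w + d) * cS + real (Suc w * m) * cR"
proof -
  let ?A = "verifier (Suc w) m t" and ?S = "set (W @ [T])"
  let ?pairs = "List.product (W @ [T]) [0..<m]"
  define h1 where "h1 = map (\<lambda>e. Sorted_Event i (Some e)) (take (w + d) (db f ! i))"
  define h where "h = h1 @ map (\<lambda>(R, j). Random_Event R j (random_result (db f) R j)) ?pairs"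
  have T_H: "T \<in> set (H i)"
    using T candidates_sub by blast
  have take: "take (w + d) (db f ! i) = map (\<lambda>R. (R, 1)) (W @ take d (H i))"
    using take_db[OF f i, of "w + d"] d W by (simp add: take_map)
  have "w + d \<le> length (db f ! i)"
    using W H[of i] d by (simp add: db_nth[OF i] list_order_def)
  then have "reachable ?A (db f) h1"
    unfolding h1_def using i by (intro reachable_verifier_sorted) (simp_all add: length_db)
  moreover have "R \<in> seen h1" if "R \<in> ?S" for R
    using that T(1) unfolding seen_eq h1_def take by (auto simp: candidates_def)
  ultimately have reach: "reachable ?A (db f) h"
    unfolding h_def by (intro reachable_verifier_random) auto
  have f_S: "m \<le> f R" if "R \<in> ?S" for R
    using that T(2) f by (auto simp: valid_def)
  have S_U: "?S \<subseteq> set U"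
    using W_sub_U H_sub_U[OF i] T_H by auto
  have card_S: "card ?S = Suc w"
  proof -
    have "T \<notin> set W"
      using W_H[of i] T_H by blast
    then show ?thesis
      using W by (simp add: distinct_card)
  qed
  \<comment> \<open>The certificate must work for every database that fits \<open>h\<close>, not
    only for \<open>db f\<close>: the recorded probes force all grades of \<open>?S\<close> to be
    1.\<close>
  have "top_answers (Suc w) t D ((\<lambda>R. (R, 1)) ` ?S)"
    if D: "D \<in> databases (Suc w) m" and hist: "history_of D h" for D
  proof -
    note len = databasesD(1)[OF D]
    have full: "map_of (D ! j) R = Some 1" if R: "R \<in> ?S" and j: "j < m" for R j
    proof -
      have "Random_Event R j (random_result (db f) R j) \<in> set h"
        using R j unfolding h_def by (auto simp: image_iff)
      then have "random_result D R j = random_result (db f) R j"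
        using history_of_Random_Event[OF hist] by metis
      then show ?thesis
        using j R f_S[OF R] S_U by (auto simp: random_result_def len length_db map_of_db)
    qed
    have S_obj: "?S \<subseteq> objects D"
    proof
      fix R assume "R \<in> ?S"
      then have "(R, 1) \<in> set (D ! i)"
        using full[OF _ i] databases_map_of[OF D i] by blast
      then show "R \<in> objects D"
        using databases_objects_iff[OF D i] by blast
    qed
    note t1 = strict_monotone_le_1[OF mono strict]
    have 1: "overall_grade t D R = 1" if "R \<in> ?S" for R
      unfolding overall_grade_eq[OF len] using full[OF that] by (subst t1(2)) auto
    have "overall_grade t D R \<le> 1" if "R \<in> objects D" for R
      unfolding overall_grade_eq[OF len]
      using grade_in_unit_interval[OF D that] by (intro t1(1))
    then have "is_top (Suc w) (overall_grade t D) (objects D) ?S"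
      using S_obj card_S 1 by (simp add: is_top_def)
    moreover have "(\<lambda>R. (R, 1)) ` ?S = (\<lambda>R. (R, overall_grade t D R)) ` ?S"
      using 1 by (intro image_cong) auto
    ultimately show ?thesis
      unfolding top_answers_def by blast
  qed
  then have "halts_with ?A (db f) h ((\<lambda>R. (R, 1)) ` ?S)"
    using reach by (simp add: halts_with_def verifier_actions)
  then have "middleware_cost cS cR ?A (db f) \<le> history_cost cS cR h"
    using assms(1,2) by (intro middleware_cost_le) auto
  also have "\<dots> = real (w + d) * cS + real (Suc w * m) * cR"
  proof -
    have "history_cost cS cR h1 = real (w + d) * cS"
      unfolding h1_def take using d H[of i] W
      by (simp add: comp_def sum_list_triv algebra_simps)
    moreover have "map (event_cost cS cR)
        (map (\<lambda>(R, j). Random_Event R j (random_result (db f) R j)) ?pairs) = map (\<lambda>_. cR) ?pairs"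
      by auto
    moreover have "length ?pairs = Suc w * m"
      using W by (simp only: length_product) simp
    ultimately show ?thesis
      unfolding h_def map_append sum_list_append by (simp only: sum_list_triv)
  qed
  finally show ?thesis .
qed

end

section \<open>The adversary\<close>

locale adversary = hard_instances w m n d t U W H
  for w m n d :: nat and t :: "real list \<Rightarrow> real" and U W :: "'a list" and H :: "nat \<Rightarrow> 'a list" +
  fixes B :: "'a algorithm" and cS cR :: real
  assumes det: "deterministic B" and B: "correct (Suc w) m t B" "no_wild_guesses (Suc w) m B"
    and cost_pos: "cS > 0" "cR > 0"
begin

text \<open>Below \<open>n * cS\<close> no list has been read to the end of its uninformative
  prefix. The final \<open>- cR\<close> leaves room for the one random access that could complete
  the probing of all candidates.\<close>

definition lower_bound :: real where
  "lower_bound = min (real n * cS) (real d * (real m * (cS + real (m - 1) * cR)) - cR)"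

text \<open>The fifth conjunct is the strategy of the adversary: a candidate shows its grade 0 only when all
  its other grades have been retrieved. Hence \<open>f\<close> can still be changed at any candidate that is not
  fully probed.\<close>

definition invariant :: "('a \<Rightarrow> nat) \<Rightarrow> 'a event list \<Rightarrow> bool" where
  "invariant f h \<longleftrightarrow> valid f \<and> (\<forall>i<m. \<forall>R\<in>set (H i). f R < m) \<and> reachable B (db f) h \<and>
     (\<forall>i<m. length (entries_seen i h) \<le> w + n) \<and>
     (\<forall>i<m. \<forall>R\<in>candidates i. (R, f R) \<in> probes h \<longrightarrow> other_lists i R \<subseteq> probes h) \<and>
     (\<exists>i<m. \<exists>R\<in>candidates i. \<not> other_lists i R \<subseteq> probes h)"

lemma valid_update:
  assumes f: "valid f" and R: "R \<in> set (H i)" and "j \<noteq> i"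
  shows "valid (f(R := j))"
proof -
  have "R \<notin> set W"
    using W_H[of i] R by auto
  moreover have "R \<notin> set (H i')" if "i' \<noteq> i" for i'
    using H_H[OF that] R by auto
  ultimately show ?thesis
    using f \<open>j \<noteq> i\<close> by (auto simp: valid_def)
qed

text \<open>Moving the grade 0 of \<open>R\<close> from list \<open>f R\<close> to list
  \<open>j\<close> changes only two fields, neither of them probed. The choice \<open>j = m\<close>
  erases it, hence the guard \<open>j < m\<close>.\<close>

lemma reachable_update:
  assumes inv: "invariant f h" and R: "R \<in> candidates i"
    and new: "(R, f R) \<notin> probes h" "j < m \<Longrightarrow> (R, j) \<notin> probes h" and "j \<noteq> i"
  shows "valid (f(R := j))" and "reachable B (db (f(R := j))) h"
proof -
  have f: "valid f" and reach: "reachable B (db f) h"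
    using inv by (simp_all add: invariant_def)
  show valid: "valid (f(R := j))"
    using f R candidates_sub assms(5) by (blast intro: valid_update)
  have "history_of (db (f(R := j))) h"
  proof (rule history_of_db_cong[OF reachable_imp_history_of[OF reach] f valid])
    show "length (entries_seen i h) \<le> w + n" if "i < m" for i
      using inv that by (simp add: invariant_def)
    show "f R' = i' \<longleftrightarrow> (f(R := j)) R' = i'" if "(R', i') \<in> probes h" "i' < m" for R' i'
      using new that by auto
  qed
  then show "reachable B (db (f(R := j))) h"
    by (rule reachable_transfer[OF reach])
qed

text \<open>A candidate that is not fully probed has not shown its grade 0, so it can be made
  perfect unnoticed.\<close>

lemma invariant_hidden_top:
  assumes "invariant f h"
  obtains i R where "i < m" and "R \<in> candidates i" and "valid (f(R := m))"
    and "reachable B (db (f(R := m))) h"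
proof -
  obtain i R where R: "i < m" "R \<in> candidates i" "\<not> other_lists i R \<subseteq> probes h"
    using assms by (auto simp: invariant_def)
  have "(R, f R) \<notin> probes h"
    using assms R unfolding invariant_def by blast
  then have "valid (f(R := m))" "reachable B (db (f(R := m))) h"
    using reachable_update[OF assms R(2), of m] R(1) by auto
  then show ?thesis
    using that R by blast
qed

text \<open>In \<open>db f\<close> only the \<open>w\<close> leaders have grade 1. Making the hidden
  candidate \<open>R\<close> perfect provides the missing top answer, so \<open>Y\<close> must
  contain \<open>R\<close> with grade 1, which is wrong on \<open>db f\<close>.\<close>

lemma invariant_not_Halt:
  assumes inv: "invariant f h"
  shows "Halt Y \<notin> B h"
proof
  assume halt: "Halt Y \<in> B h"
  have f: "valid f" and reach: "reachable B (db f) h"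
    using inv by (simp_all add: invariant_def)
  obtain i R where R: "i < m" "R \<in> candidates i" and f': "valid (f(R := m))"
      and reach': "reachable B (db (f(R := m))) h"
    using invariant_hidden_top[OF inv] by blast
  let ?g = "overall_grade t (db f)" and ?g' = "overall_grade t (db (f(R := m)))"
  have less: "f R' < m" if "R' \<in> set U - set W" for R'
    using inv that U(2) by (auto simp: invariant_def)
  have R_H: "R \<in> set (H i)"
    using R candidates_sub by blast
  then have R_U: "R \<in> set U - set W"
    using H_sub_U[OF R(1)] W_H[of i] by auto
  have "top_answers (Suc w) t (db (f(R := m))) Y"
    using B(1) db_databases(1)[OF f'] halt reach' by (auto simp: correct_def halts_with_def)
  then obtain S where S: "S \<subseteq> set U" "card S = Suc w"
      "\<And>R R'. R \<in> S \<Longrightarrow> R' \<in> set U - S \<Longrightarrow> ?g' R' \<le> ?g' R" and Y: "Y = (\<lambda>R. (R, ?g' R)) ` S"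
    unfolding top_answers_def is_top_def db_databases(2)[OF f'] by blast
  have g'_R: "?g' R = 1"
    using overall_grade_db_eq_1[of R] R_U by simp
  have "R \<in> S"
  proof (rule ccontr)
    assume "R \<notin> S"
    \<comment> \<open>\<open>S\<close> has one element more than \<open>W\<close>, so without
      \<open>R\<close> it would contain an imperfect object.\<close>
    have "\<not> S \<subseteq> set W"
      using S(2) W card_mono[of "set W" S] distinct_card[of W] by auto
    then obtain R' where R': "R' \<in> S" "R' \<notin> set W"
      by blast
    have "R' \<in> set U" "R' \<noteq> R"
      using R'(1) S(1) \<open>R \<notin> S\<close> by auto
    then have "?g' R' \<noteq> 1"
      using overall_grade_db_eq_1[of R' "f(R := m)"] less[of R'] R'(2) by simp
    then have "?g' R' < 1"
      using overall_grade_db_le_1[of R' "f(R := m)"] R'(1) S(1) by force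
    then show False
      using S(3)[OF R'(1), of R] \<open>R \<notin> S\<close> R_U g'_R by simp
  qed
  then have RY: "(R, 1) \<in> Y"
    unfolding Y using g'_R by force
  have "top_answers (Suc w) t (db f) Y"
    using B(1) db_databases(1)[OF f] halt reach by (auto simp: correct_def halts_with_def)
  then have "?g R = 1"
    using RY unfolding top_answers_def by auto
  then show False
    using overall_grade_db_eq_1[of R f] R_U less[of R] by simp
qed

text \<open>All \<open>m * d\<close> candidates have \<open>m - 1\<close> probes each. Without wild
  guesses each must also have been seen, which takes a sorted access of its own.\<close>

lemma cost_all_probed:
  assumes f: "valid f" and reach: "reachable B (db f) h"
    and all: "\<And>i R. i < m \<Longrightarrow> R \<in> candidates i \<Longrightarrow> other_lists i R \<subseteq> probes h"
  shows "real d * (real m * (cS + real (m - 1) * cR)) \<le> history_cost cS cR h"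
proof -
  have "(\<Union>i<m. candidates i) \<subseteq> seen h"
  proof
    fix R assume "R \<in> (\<Union>i<m. candidates i)"
    then obtain i where i: "i < m" "R \<in> candidates i"
      by blast
    \<comment> \<open>Since \<open>m \<ge> 2\<close>, each candidate has at least one probed field,
      which forces it to have been seen.\<close>
    obtain j where "j < m" "j \<noteq> i"
    proof (cases "i = 0")
      case True
      then show ?thesis using that[of 1] m by simp
    next
      case False
      then show ?thesis using that[of 0] m by simp
    qed
    then have "(R, j) \<in> probes h"
      using all[OF i] by (auto simp: other_lists_def)
    then show "R \<in> seen h"
      using no_wild_guesses_Random_seen[OF B(2) db_databases(1)[OF f] reach]
      by (auto simp: probes_def)
  qed
  then have s: "m * d \<le> card (seen h)"
    unfolding card_all_candidates[symmetric] by (rule card_mono[OF finite_seen])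
  have "candidates i \<times> ({..<m} - {i}) \<subseteq> probes h" if "i < m" for i
    using all[OF that] by (auto simp: other_lists_def)
  then have "(\<Union>i<m. candidates i \<times> ({..<m} - {i})) \<subseteq> probes h"
    by (intro UN_least) simp
  then have p: "m * d * (m - 1) \<le> card (probes h)"
    unfolding card_all_other_lists[symmetric] by (rule card_mono[OF finite_probes])
  have "real d * (real m * (cS + real (m - 1) * cR)) =
      cS * real (m * d) + cR * real (m * d * (m - 1))"
    unfolding of_nat_mult by (simp only: distrib_left mult_ac)
  also have "\<dots> \<le> cS * real (card (seen h)) + cR * real (card (probes h))"
    using s p cost_pos by (intro add_mono mult_left_mono) (auto simp only: of_nat_le_iff)
  also have "\<dots> \<le> history_cost cS cR h"
    using cost_pos by (intro history_cost_ge) auto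
  finally show ?thesis .
qed

text \<open>The reply of the adversary to the next access of \<open>B\<close>. It changes
  \<open>f\<close> only when a random access would hit a grade 0 too early.\<close>

lemma invariant_step:
  assumes inv: "invariant f h" and cheap: "history_cost cS cR h < lower_bound"
  obtains f' e where "invariant f' (h @ [e])"
proof -
  have f: "valid f" and full: "\<And>i R. i < m \<Longrightarrow> R \<in> set (H i) \<Longrightarrow> f R < m"
    and reach: "reachable B (db f) h"
    and depth: "\<And>i. i < m \<Longrightarrow> length (entries_seen i h) \<le> w + n"
    and zero: "\<And>i R. \<lbrakk>i < m; R \<in> candidates i; (R, f R) \<in> probes h\<rbrakk> \<Longrightarrow>
        other_lists i R \<subseteq> probes h"
    using inv by (auto simp: invariant_def)
  obtain i0 R0 where R0: "i0 < m" "R0 \<in> candidates i0" "\<not> other_lists i0 R0 \<subseteq> probes h"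
    using inv by (auto simp: invariant_def)
  obtain a where a: "a \<in> B h"
    using det by (metis deterministic_def is_singleton_def singletonI)
  show ?thesis
  proof (cases a)
    case (Halt Y)
    then show ?thesis
      using a invariant_not_Halt[OF inv] by blast
  next
    case (Do_Sorted j)
    define e where "e = Sorted_Event j (sorted_result (db f) h j)"
    have reach': "reachable B (db f) (h @ [e])"
      unfolding e_def using reach a Do_Sorted by (intro reachable.sorted_step) auto
    have probes: "probes (h @ [e]) = probes h"
      by (auto simp: probes_def e_def)
    \<comment> \<open>A cheap history has read fewer than \<open>n\<close> entries of each list, so
      one more access stays within the prefix that does not depend on \<open>f\<close>.\<close>
    have "length (entries_seen i (h @ [e])) \<le> w + n" if "i < m" for i
    proof -
      have "cS * real (length (entries_seen i h)) \<le> cS * real (card (seen h))"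
        using length_entries_seen_le_card_seen[OF db_databases(1)[OF f]
            reachable_imp_history_of[OF reach], of i] cost_pos
        by (intro mult_left_mono) auto
      also have "\<dots> \<le> cS * real (card (seen h)) + cR * real (card (probes h))"
        using cost_pos by simp
      also have "\<dots> \<le> history_cost cS cR h"
        using cost_pos by (intro history_cost_ge) auto
      also have "\<dots> < cS * real n"
        using cheap by (simp add: lower_bound_def mult.commute)
      finally have "length (entries_seen i h) < n"
        using cost_pos by simp
      moreover have "length (entries_seen i (h @ [e])) \<le> Suc (length (entries_seen i h))"
        by (simp add: e_def entries_seen_snoc_Sorted split: option.splits)
      ultimately show ?thesis
        by simp
    qed
    then have "invariant f (h @ [e])"
      unfolding invariant_def probes using f full reach' zero R0 by blast
    then show ?thesis
      by (rule that)
  next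
    case (Do_Random S j)
    define e where "e f' = Random_Event S j (random_result (db f') S j)" for f'
    have reach_e: "reachable B (db f') (h @ [e f'])" if "reachable B (db f') h" for f'
      unfolding e_def using that a Do_Random by (intro reachable.random_step) auto
    have probes: "probes (h @ [e f']) = insert (S, j) (probes h)" for f'
      by (auto simp: probes_def e_def)
    have depth': "length (entries_seen i (h @ [e f'])) \<le> w + n" if "i < m" for i f'
      using depth[OF that] by (simp add: e_def entries_seen_snoc_Random)
    show ?thesis
    \<comment> \<open>The critical case: the access hits the grade 0 of a candidate that has another
      unprobed field \<open>j'\<close>. The grade 0 then moves to \<open>j'\<close>, and the access
      returns 1.\<close>
    proof (cases "\<exists>i<m. S \<in> candidates i \<and> f S = j \<and>
        (\<exists>j'. (S, j') \<in> other_lists i S \<and> j' \<noteq> j \<and> (S, j') \<notin> probes h)")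
      case True
      then obtain i j' where i: "i < m" "S \<in> candidates i" "f S = j"
        and j': "(S, j') \<in> other_lists i S" "j' \<noteq> j" "(S, j') \<notin> probes h"
        by blast
      \<comment> \<open>Had this grade 0 been shown before, the invariant would require
        \<open>j'\<close> to be probed.\<close>
      have "(S, f S) \<notin> probes h"
        using zero[OF i(1,2)] j' by blast
      moreover have j'_less: "j' < m" "j' \<noteq> i"
        using j'(1) by (auto simp: other_lists_def)
      ultimately have f': "valid (f(S := j'))" and reach': "reachable B (db (f(S := j'))) h"
        using reachable_update[OF inv i(2), of j'] j'(3) by auto
      let ?f = "f(S := j')"
      have "\<forall>i<m. \<forall>R\<in>set (H i). ?f R < m"
        using full j'_less by auto
      moreover have "other_lists i' R \<subseteq> probes (h @ [e ?f])"
        if "i' < m" "R \<in> candidates i'" "(R, ?f R) \<in> probes (h @ [e ?f])" for i' R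
      proof (cases "R = S")
        case True
        then show ?thesis
          using that(3) j' by (simp add: probes)
      next
        case False
        then show ?thesis
          using that zero[OF that(1,2)] by (auto simp: probes)
      qed
      moreover have "\<not> other_lists i S \<subseteq> probes (h @ [e ?f])"
        using j' by (auto simp: probes)
      ultimately have "invariant ?f (h @ [e ?f])"
        unfolding invariant_def using f' reach_e[OF reach'] depth' i(1,2) by blast
      then show ?thesis
        by (rule that)
    next
      case False
      have "other_lists i R \<subseteq> probes (h @ [e f])"
        if iR: "i < m" "R \<in> candidates i" "(R, f R) \<in> probes (h @ [e f])" for i R
      proof (cases "(R, f R) \<in> probes h")
        case True
        then show ?thesis
          using zero[OF iR(1,2)] by (auto simp: probes)
      next
        case new: False
        \<comment> \<open>The grade 0 is shown just now; outside the critical case all other fields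
          of the candidate were already probed.\<close>
        then have "R = S" "f S = j"
          using iR(3) by (auto simp: probes)
        then show ?thesis
          using False iR(1,2) by (auto simp: probes other_lists_def)
      qed
      \<comment> \<open>Completing all probes with this access would cost at most \<open>cR\<close>
        more than \<open>h\<close>, which the \<open>- cR\<close> in \<open>lower_bound\<close>
        rules out.\<close>
      moreover have "\<exists>i<m. \<exists>R\<in>candidates i. \<not> other_lists i R \<subseteq> probes (h @ [e f])"
      proof (rule ccontr)
        assume "\<not> ?thesis"
        then have "real d * (real m * (cS + real (m - 1) * cR)) \<le> history_cost cS cR (h @ [e f])"
          by (intro cost_all_probed[OF f reach_e[OF reach]]) blast
        also have "\<dots> = history_cost cS cR h + cR"
          by (simp add: e_def)
        finally show False
          using cheap by (simp add: lower_bound_def)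
      qed
      ultimately have "invariant f (h @ [e f])"
        unfolding invariant_def using f full reach_e[OF reach] depth' by blast
      then show ?thesis
        by (rule that)
    qed
  qed
qed

lemma invariant_initial: "\<exists>f. invariant f []"
proof -
  \<comment> \<open>Every object other than a leader starts with its grade 0 in list 0, except that
    \<open>H 0\<close> must use list 1.\<close>
  define f where "f R = (if R \<in> set W then m else if R \<in> set (H 0) then 1 else 0)" for R
  have H_not_W: "R \<notin> set W" if "R \<in> set (H i)" for R i
    using W_H[of i] that by auto
  have "f R \<noteq> i" if "R \<in> set (H i)" for R i
  proof (cases "i = 0")
    case False
    then have "R \<notin> set (H 0)"
      using H_H[OF False] that by auto
    then show ?thesis
      using H_not_W[OF that] False by (simp add: f_def)
  qed (use that H_not_W[OF that] in \<open>simp add: f_def\<close>)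
  then have "valid f"
    by (simp add: valid_def f_def)
  moreover have "\<forall>i<m. \<forall>R\<in>set (H i). f R < m"
    using m H_not_W by (auto simp: f_def)
  moreover have "\<exists>R. R \<in> candidates 0"
    using card_candidates[of 0] d(1) by (metis card.empty ex_in_conv not_one_le_zero)
  then obtain R where "R \<in> candidates 0"
    by blast
  moreover have "(R, 1) \<in> other_lists 0 R"
    using m by (auto simp: other_lists_def)
  then have "\<not> other_lists 0 R \<subseteq> {}"
    by blast
  moreover have "probes [] = {}"
    by (simp add: probes_def)
  moreover have "0 < m"
    using m by simp
  ultimately have "invariant f []"
    unfolding invariant_def by (simp add: reachable.start) blast
  then show ?thesis by blast
qed

text \<open>Otherwise the adversary could reply forever while the cost stays bounded, although each
  access costs at least \<open>min cS cR\<close>.\<close>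

lemma expensive_history: "\<exists>f h. invariant f h \<and> lower_bound \<le> history_cost cS cR h"
proof (rule ccontr)
  assume "\<not> ?thesis"
  then have cheap: "history_cost cS cR h < lower_bound" if "invariant f h" for f h
    using that by force
  have long: "\<exists>f h. invariant f h \<and> length h = p" for p
  proof (induction p)
    case 0
    then show ?case
      using invariant_initial by auto
  next
    case (Suc p)
    then obtain f h where "invariant f h" "length h = p"
      by blast
    then show ?case
      using invariant_step cheap by (metis length_append_singleton)
  qed
  have "real (length h) * min cS cR \<le> history_cost cS cR h" for h :: "'a event list"
  proof (induction h)
    case (Cons e h)
    then show ?case
      by (cases e) (simp_all add: algebra_simps min_def split: if_splits)
  qed simp
  moreover obtain p where "lower_bound < real p * min cS cR"
    using ex_less_of_nat_mult[of "min cS cR" lower_bound] cost_pos by auto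
  moreover obtain f h where "invariant f h" "length h = p"
    using long by blast
  ultimately show False
    using cheap by (metis less_asym less_le_trans)
qed

text \<open>Making the hidden candidate perfect turns the expensive history into the start of a run
  on a database that the verifier handles cheaply.\<close>

lemma expensive_instance:
  obtains f i R where "i < m" and "R \<in> candidates i" and "valid f" and "m \<le> f R"
    and "lower_bound \<le> middleware_cost cS cR B (db f)"
proof -
  obtain f h where inv: "invariant f h" and cost: "lower_bound \<le> history_cost cS cR h"
    using expensive_history by blast
  obtain i R where R: "i < m" "R \<in> candidates i" "valid (f(R := m))"
      and reach: "reachable B (db (f(R := m))) h"
    using invariant_hidden_top[OF inv] by blast
  have "lower_bound \<le> middleware_cost cS cR B (db (f(R := m)))"
  proof (rule middleware_cost_ge[OF B(1) db_databases(1)[OF R(3)]])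
    fix g Y assume "halts_with B (db (f(R := m))) g Y"
    then obtain g' where "g = h @ g'"
      using deterministic_halt_extends[OF det reach] by blast
    then show "lower_bound \<le> history_cost cS cR g"
      using cost history_cost_nonneg[of cS cR g'] cost_pos by simp
  qed
  then show ?thesis
    using that[OF R] by simp
qed

end

text \<open>Each further candidate per list costs \<open>B\<close> another \<open>\<rho>\<close> and
  the verifier only \<open>cS\<close>. If \<open>c\<close> is below the ratio, this gap outgrows
  every additive constant as \<open>d\<close> increases.\<close>

lemma instance_optimal_ratio_ge:
  fixes B :: "'a::infinite algorithm" and tie :: "'a event list \<Rightarrow> 'a set"
  assumes "k \<ge> 1" and "m \<ge> 2" and "cS > 0" and "cR > 0"
    and mono: "monotone_aggregation m t" and strict: "strict_aggregation m t"
    and tie: "tie_breaking k m t tie" and det: "deterministic B"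
    and opt: "instance_optimal (middleware_cost cS cR) (algorithms k m t) (databases k m) B c"
  shows "ta_ratio m cS cR \<le> c"
proof (rule ccontr)
  assume less: "\<not> ta_ratio m cS cR \<le> c"
  define w where "w = k - 1"
  have k: "k = Suc w"
    using assms(1) by (simp add: w_def)
  have B: "correct (Suc w) m t B" "no_wild_guesses (Suc w) m B"
    using opt by (simp_all add: instance_optimal_def algorithms_def k)
  obtain c' where c': "\<And>A D. A \<in> algorithms k m t \<Longrightarrow> D \<in> databases k m \<Longrightarrow>
      middleware_cost cS cR B D \<le> c * middleware_cost cS cR A D + c'"
    using opt unfolding instance_optimal_def by blast
  define \<rho> where "\<rho> = real m * (cS + real (m - 1) * cR)"
  have \<rho>: "\<rho> = ta_ratio m cS cR * cS"
    using assms(2,3) by (simp add: \<rho>_def ta_ratio_def field_simps of_nat_diff)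
  have "\<rho> > 0"
    using assms(2-4) by (auto simp: \<rho>_def intro!: mult_pos_pos add_pos_nonneg)
  \<comment> \<open>\<open>c\<close> might be negative; the upper bound on the verifier's cost can
    only be multiplied by a nonnegative factor.\<close>
  define a where "a = max c 0"
  have gap: "\<rho> - a * cS > 0"
    using less \<open>\<rho> > 0\<close> assms(3) by (auto simp: \<rho> a_def max_def zero_less_mult_iff)
  \<comment> \<open>Everything independent of \<open>d\<close>: the verifier's cost for leaders and
    probes, the additive constant, and the \<open>cR\<close> lost in
    \<open>lower_bound\<close>.\<close>
  define K where "K = a * (real w * cS + real (Suc w * m) * cR) + c' + cR"
  obtain d' where d': "K < real d' * (\<rho> - a * cS)"
    using ex_less_of_nat_mult[OF gap] by blast
  define d where "d = Suc d'"
  have K: "K < real d * (\<rho> - a * cS)"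
    using d' gap by (simp add: d_def algebra_simps)
  \<comment> \<open>\<open>n\<close> is taken so large that reading through a prefix is no cheaper
    than probing all candidates.\<close>
  obtain n' where n': "real d * \<rho> < real n' * cS"
    using ex_less_of_nat_mult[OF assms(3)] by blast
  define n where "n = d + n'"
  have n: "real d * \<rho> \<le> real n * cS"
    using n' assms(3) by (simp add: n_def algebra_simps add_increasing)
  obtain e :: "nat \<Rightarrow> 'a" where e: "inj e"
    using infinite_countable_subset[OF infinite_UNIV] by blast
  \<comment> \<open>An initial segment of the embedded naturals is cut into \<open>w\<close> leaders
    and \<open>m\<close> consecutive blocks of length \<open>n\<close>.\<close>
  define W where "W = map e [0..<w]"
  define H where "H i = map e [w + i * n..<w + Suc i * n]" for i
  define U where "U = map e [0..<w + m * n]"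
  have disj: "{w + i * n..<w + Suc i * n} \<inter> {w + j * n..<w + Suc j * n} = {}" if "i < j" for i j
  proof -
    have "Suc i * n \<le> j * n"
      using that by (intro mult_right_mono) auto
    then show ?thesis
      by auto
  qed
  have "{0..<w + m * n} = {0..<w} \<union> (\<Union>i<m. {w + i * n..<w + Suc i * n})"
  proof (induction m)
    case (Suc m)
    have "{0..<w + Suc m * n} = {0..<w + m * n} \<union> {w + m * n..<w + Suc m * n}"
      by auto
    then show ?case
      unfolding Suc by (auto simp: lessThan_Suc)
  qed simp
  then have U: "set U = set W \<union> (\<Union>i<m. set (H i))"
    unfolding U_def W_def H_def set_map set_upt by (simp add: image_Un image_UN)
  interpret adversary w m n d t U W H B cS cR
  proof
    show "set (H i) \<inter> set (H j) = {}" if "i \<noteq> j" for i j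
      using disj[of i j] disj[of j i] that unfolding H_def set_map set_upt
      by (cases "i < j") (auto simp: image_Int[OF e, symmetric] Int_commute)
    show "set W \<inter> set (H i) = {}" for i
      unfolding H_def W_def set_map set_upt image_Int[OF e, symmetric] by auto
    show "distinct U" "distinct W" "distinct (H i)" for i
      using e by (auto simp: U_def W_def H_def distinct_map intro: inj_on_subset)
  qed (use assms U B in \<open>simp_all add: d_def n_def W_def H_def\<close>)
  obtain f i R where R: "i < m" "R \<in> candidates i" and f: "valid f" "m \<le> f R"
      and lower: "lower_bound \<le> middleware_cost cS cR B (db f)"
    using expensive_instance by blast
  let ?V = "verifier k m t :: 'a algorithm"
  have upper: "middleware_cost cS cR ?V (db f) \<le> real (w + d) * cS + real (Suc w * m) * cR"
    unfolding k by (rule middleware_cost_verifier_le[OF assms(3,4) f(1) R f(2)])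
  have V: "?V \<in> algorithms k m t"
    using verifier_in_algorithms[OF assms(1) _ mono tie] assms(2) by simp
  have db: "db f \<in> databases k m"
    unfolding k by (rule db_databases(1)[OF f(1)])
  have nonneg: "0 \<le> middleware_cost cS cR ?V (db f)"
    using V db assms(3,4) by (intro middleware_cost_ge[of k m t])
      (auto simp: algorithms_def intro!: history_cost_nonneg)
  have "real d * \<rho> - cR \<le> lower_bound"
    using n assms(4) by (simp add: lower_bound_def \<rho>_def)
  also note lower
  also have "middleware_cost cS cR B (db f) \<le> c * middleware_cost cS cR ?V (db f) + c'"
    by (rule c'[OF V db])
  also have "\<dots> \<le> a * middleware_cost cS cR ?V (db f) + c'"
    using nonneg by (simp add: a_def mult_right_mono)
  also have "\<dots> \<le> a * (real (w + d) * cS + real (Suc w * m) * cR) + c'"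
    using upper by (simp add: a_def mult_left_mono)
  finally show False
    using K by (simp add: K_def algebra_simps)
qed

theorem corollary6p2:
  fixes k m :: nat
    and cS cR :: real
    and t :: "real list \<Rightarrow> real"
    and tie :: "'a::infinite event list \<Rightarrow> 'a set"
  assumes "k \<ge> 1" and "m \<ge> 1" and "cS > 0" and "cR > 0"
    and "aggregation m t" and "monotone_aggregation m t" and "strict_aggregation m t"
    and "tie_breaking k m t tie"
  shows "instance_optimal (middleware_cost cS cR) (algorithms k m t) (databases k m)
           (TA k m t tie) (ta_ratio m cS cR) \<and>
         (m \<ge> 2 \<longrightarrow>
           \<not> (\<exists>(B :: 'a algorithm) c. deterministic B \<and> c < ta_ratio m cS cR \<and>
                instance_optimal (middleware_cost cS cR) (algorithms k m t) (databases k m) B c))"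
proof (intro conjI impI notI)
  show "instance_optimal (middleware_cost cS cR) (algorithms k m t) (databases k m)
      (TA k m t tie) (ta_ratio m cS cR)"
    using assms by (intro TA_instance_optimal)
  assume "m \<ge> 2"
  assume "\<exists>(B :: 'a algorithm) c. deterministic B \<and> c < ta_ratio m cS cR \<and>
      instance_optimal (middleware_cost cS cR) (algorithms k m t) (databases k m) B c"
  then show False
    using instance_optimal_ratio_ge[OF assms(1) \<open>m \<ge> 2\<close> assms(3,4,6-8)] by force
qed

end
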